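(* Let $(\alpha,\tilde\beta)$ and $(\alpha',\tilde\beta')$ in $\mathfrak{k}_{\mathbb{R}}^\vee\times\mathfrak{k}^\vee$ be generic, i.e. regular values of $\widetilde{\mu}_{\mathrm{K}}=(\widetilde{\mu}_{\mathbb{R},\mathrm{K}},\widetilde{\mu}_{\mathbb{C},\mathrm{K}})$. Then $\widetilde{\mathfrak{M}}^\tau_u(\alpha,\tilde\beta)$ is homeomorphic to $\widetilde{\mathfrak{M}}^\tau_u(\alpha',\tilde\beta')$.
   Context: Fix $\tau$ in the upper half-plane, $\Gamma=\mathbb{Z}+\mathbb{Z}\tau$, $q=e^{2\pi i\tau}$. Let $\vartheta(x)=(t^{1/2}-t^{-1/2})\prod_{m>0}(1-q^mt)(1-q^mt^{-1})$ with $t=e^{2\pi ix}$, and $\widetilde{X}_\vartheta=\{(z,w,x)\in\mathbb{C}^3: zw=\vartheta(x)\}$. Let $\mathfrak{t},\mathfrak{a}$ be complex vector spaces of dimensions $n,d$ with lattices $\mathfrak{t}_{\mathbb{Z}},\mathfrak{a}_{\mathbb{Z}}$, $e_1,\dots,e_n$ a $\mathbb{Z}$-basis of $\mathfrak{t}_{\mathbb{Z}}$ with dual basis $e_i^\vee$, and $u=\{u_1,\dots,u_n\}\subset\mathfrak{a}_{\mathbb{Z}}$ primitive vectors spanning $\mathfrak{a}_{\mathbb{Z}}$ over $\mathbb{Z}$. Let $\pi:\mathfrak{t}\to\mathfrak{a}$, $\pi(e_i)=u_i$, $\mathfrak{k}=\ker\pi$ (dimension $k=n-d$), $\iota:\mathfrak{k}\to\mathfrak{t}$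 the inclusion and $\iota^\vee:\mathfrak{t}^\vee\to\mathfrak{k}^\vee$ its dual. Let $\mathrm{T}=\mathfrak{t}/\mathfrak{t}_{\mathbb{Z}}\cong(\mathbb{C}^\times)^n$, $\mathrm{A}=\mathfrak{a}/\mathfrak{a}_{\mathbb{Z}}$, $\mathrm{K}=\ker(\mathrm{T}\to\mathrm{A})$, with $\mathrm{K}_{\mathbb{R}}$ its maximal compact subtorus. $\mathrm{T}$ acts on $\widetilde{X}_\vartheta^n$ by $t\cdot(z_i,w_i,x_i)_i=(t_iz_i,t_i^{-1}w_i,x_i)_i$. Equip $\widetilde{X}_\vartheta^n$ with the holomorphic symplectic form $\sum_i\mathrm{Res}\frac{dz_i\wedge dw_i\wedge dx_i}{z_iw_i-\vartheta(x_i)}$ and the Kähler form $\frac{\sqrt{-1}}{2}\partial\bar\partial\sum_i\left(|z_i|^2+e^{-2\pi(\mathrm{Im}\,x_i)^2/\mathrm{Im}\,\tau}|w_i|^2+\frac{|x_i|^2}{\mathrm{Im}\,\tau}\right)$. The moment maps for $\mathrm{K}$ and $\mathrm{K}_{\mathbb{R}}$ are $\widetilde{\mu}_{\mathbb{C},\mathrm{K}}(z,w,x)=\sum_i x_i\,\iota^\vee e_i^\vee\in\mathfrak{k}^\vee$ and $\widetilde{\mu}_{\mathbb{R},\mathrm{K}}(z,w,x)=\frac12\sum_i\left(|z_i|^2-e^{-2\pi(\mathrm{Im}\,x_i)^2/\mathrm{Im}\,\tau}|w_i|^2\right)\iota^\vee e_i^\vee\in\mathfrak{k}^\vee_{\mathbb{R}}$.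 For $(\alpha,\tilde\beta)\in\mathfrak{k}_{\mathbb{R}}^\vee\times\mathfrak{k}^\vee$ define $\widetilde{\mathfrak{M}}^\tau_u(\alpha,\tilde\beta)=(\widetilde{\mu}_{\mathbb{R},\mathrm{K}},\widetilde{\mu}_{\mathbb{C},\mathrm{K}})^{-1}(\alpha,\tilde\beta)/\mathrm{K}_{\mathbb{R}}$. *)

theory Defs
  imports "HOL-Analysis.Analysis"
begin

text \<open>Conventions. The torus T has Lie algebra t = complex^'n (basis e_i = axis i 1),
 the torus A has Lie algebra a = complex^'d with lattice int^'d; u :: 'n => int^'d
 gives pi(e_i) = u_i. A point of the n-fold product of Xtheta is a triple
 (z, w, x) of vectors in complex^'n.\<close>

definition nome :: "complex \<Rightarrow> complex" where
  "nome \<tau> = exp (2 * pi * \<i> * \<tau>)"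

definition theta :: "complex \<Rightarrow> complex \<Rightarrow> complex" where
  "theta \<tau> x = (exp (pi * \<i> * x) - exp (- pi * \<i> * x)) *
     prodinf (\<lambda>m. (1 - nome \<tau> ^ Suc m * exp (2 * pi * \<i> * x))
                 * (1 - nome \<tau> ^ Suc m * exp (- 2 * pi * \<i> * x)))"

type_synonym 'n pt = "(complex^'n) \<times> (complex^'n) \<times> (complex^'n)"

definition Xn :: "complex \<Rightarrow> 'n::finite pt set" where
  "Xn \<tau> = {(z, w, x). \<forall>i. z$i * w$i = theta \<tau> (x$i)}"

definition Feq :: "complex \<Rightarrow> 'n::finite pt \<Rightarrow> complex^'n" where
  "Feq \<tau> p = (case p of (z, w, x) \<Rightarrow> (\<chi> i. z$i * w$i - theta \<tau> (x$i)))"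

definition piu :: "('n::finite \<Rightarrow> int^'d::finite) \<Rightarrow> complex^'n \<Rightarrow> complex^'d" where
  "piu u \<xi> = (\<chi> j. \<Sum>i\<in>UNIV. \<xi>$i * of_int (u i $ j))"

definition kC :: "('n::finite \<Rightarrow> int^'d::finite) \<Rightarrow> (complex^'n) set" where
  "kC u = {\<zeta>. piu u \<zeta> = 0}"

definition kR :: "('n::finite \<Rightarrow> int^'d::finite) \<Rightarrow> (real^'n) set" where
  "kR u = {\<xi>. piu u (\<chi> i. complex_of_real (\<xi>$i)) = 0}"

text \<open>K_R: the maximal compact subtorus of K = ker(T -> A), i.e. the elements
 t = exp(2 pi i xi) with xi real and pi(xi) in the lattice a_Z.\<close>
definition KR :: "('n::finite \<Rightarrow> int^'d::finite) \<Rightarrow> (complex^'n) set" where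
  "KR u = {t. \<exists>\<xi>::real^'n. (\<forall>i. t$i = exp (2 * pi * \<i> * complex_of_real (\<xi>$i))) \<and>
              (\<forall>j. \<exists>m::int. piu u (\<chi> i. complex_of_real (\<xi>$i)) $ j = of_int m)}"

definition act :: "complex^'n::finite \<Rightarrow> 'n pt \<Rightarrow> 'n pt" where
  "act t p = (case p of (z, w, x) \<Rightarrow> ((\<chi> i. t$i * z$i), (\<chi> i. inverse (t$i) * w$i), x))"

text \<open>Lifted moment maps with values in t_R^dual = real^'n and t^dual = complex^'n
 (coefficients w.r.t. the dual basis e_i^dual); the K-moment maps are obtained by
 composing with iota^dual, i.e. restricting these functionals to k_R resp. k.\<close>
definition muR :: "complex \<Rightarrow> 'n::finite pt \<Rightarrow> real^'n" where
  "muR \<tau> p = (case p of (z, w, x) \<Rightarrow>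
     (\<chi> i. (1/2) * ((cmod (z$i))^2 - exp (- 2 * pi * (Im (x$i))^2 / Im \<tau>) * (cmod (w$i))^2)))"

definition muC :: "'n::finite pt \<Rightarrow> complex^'n" where
  "muC p = (case p of (z, w, x) \<Rightarrow> x)"

text \<open>Two elements of t_R^dual (resp. t^dual) have the same image under iota^dual
 iff they agree on k_R (resp. k).\<close>
definition iotaR_eq :: "('n::finite \<Rightarrow> int^'d::finite) \<Rightarrow> real^'n \<Rightarrow> real^'n \<Rightarrow> bool" where
  "iotaR_eq u a b \<longleftrightarrow> (\<forall>\<xi>\<in>kR u. (\<Sum>i\<in>UNIV. a$i * \<xi>$i) = (\<Sum>i\<in>UNIV. b$i * \<xi>$i))"

definition iotaC_eq :: "('n::finite \<Rightarrow> int^'d::finite) \<Rightarrow> complex^'n \<Rightarrow> complex^'n \<Rightarrow> bool" where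
  "iotaC_eq u a b \<longleftrightarrow> (\<forall>\<zeta>\<in>kC u. (\<Sum>i\<in>UNIV. a$i * \<zeta>$i) = (\<Sum>i\<in>UNIV. b$i * \<zeta>$i))"

text \<open>Level set (mu_R,K, mu_C,K)^-1(alpha, beta) where alpha = iota^dual a, beta = iota^dual b.\<close>
definition level :: "complex \<Rightarrow> ('n::finite \<Rightarrow> int^'d::finite) \<Rightarrow> real^'n \<Rightarrow> complex^'n \<Rightarrow> 'n pt set" where
  "level \<tau> u a b = {p \<in> Xn \<tau>. iotaR_eq u (muR \<tau> p) a \<and> iotaC_eq u (muC p) b}"

text \<open>Regular value: at every point p of the level set, the differential of
 mu_K = (iota^dual o mu_R, iota^dual o mu_C), restricted to the (real) tangent space
 T_p Xn = ker dF_p, is surjective onto k_R^dual x k^dual.\<close>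
definition regular_value :: "complex \<Rightarrow> ('n::finite \<Rightarrow> int^'d::finite) \<Rightarrow> real^'n \<Rightarrow> complex^'n \<Rightarrow> bool" where
  "regular_value \<tau> u a b \<longleftrightarrow>
     (\<forall>p\<in>level \<tau> u a b. \<exists>DF DM.
        (Feq \<tau> has_derivative DF) (at p) \<and>
        ((\<lambda>q. (muR \<tau> q, muC q)) has_derivative DM) (at p) \<and>
        (\<forall>(c::real^'n) (e::complex^'n). \<exists>v. DF v = 0 \<and>
             iotaR_eq u (fst (DM v)) c \<and> iotaC_eq u (snd (DM v)) e))"

definition quotient_topology :: "'a topology \<Rightarrow> 'a set \<Rightarrow> ('a \<times> 'a) set \<Rightarrow> 'a set topology" where
  "quotient_topology X S r = topology (\<lambda>U. U \<subseteq> S // r \<and> openin X (\<Union>U))"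

definition orbit_rel :: "complex \<Rightarrow> ('n::finite \<Rightarrow> int^'d::finite) \<Rightarrow> real^'n \<Rightarrow> complex^'n \<Rightarrow> ('n pt \<times> 'n pt) set" where
  "orbit_rel \<tau> u a b = {(p, p'). p \<in> level \<tau> u a b \<and> p' \<in> level \<tau> u a b \<and> (\<exists>t\<in>KR u. p' = act t p)}"

definition Mtilde :: "complex \<Rightarrow> ('n::finite \<Rightarrow> int^'d::finite) \<Rightarrow> real^'n \<Rightarrow> complex^'n \<Rightarrow> 'n pt set topology" where
  "Mtilde \<tau> u a b = quotient_topology (subtopology euclidean (level \<tau> u a b))
                       (level \<tau> u a b) (orbit_rel \<tau> u a b)"

definition primitive_vec :: "int^'d::finite \<Rightarrow> bool" where
  "primitive_vec v \<longleftrightarrow> v \<noteq> 0 \<and> (\<forall>(m::int) (y::int^'d). v = m *s y \<longrightarrow> \<bar>m\<bar> = 1)"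

definition spans_lattice :: "('n::finite \<Rightarrow> int^'d::finite) \<Rightarrow> bool" where
  "spans_lattice u \<longleftrightarrow> (\<forall>y::int^'d. \<exists>c::int^'n. (\<Sum>i\<in>UNIV. c$i *s u i) = y)"

end

theory Submission
  imports Defs
begin

text \<open>
  The moment maps fibre the level set over the affine space of all \<open>(r, x)\<close> in
  \<open>\<real>\<^sup>n \<times> \<complex>\<^sup>n\<close> with prescribed images in the duals of the relation spaces; the fibres are
  tori that degenerate in the coordinate \<open>i\<close> exactly where \<open>r\<^sub>i = 0\<close> and \<open>theta (x\<^sub>i) = 0\<close>.
  A value is generic iff the vectors \<open>u\<^sub>i\<close> of simultaneously degenerate coordinates are always
  linearly independent, and then a change of the parameters can be absorbed by displacing only
  nondegenerate coordinates.

  Displacements that move only \<open>r\<close> or only \<open>x\<close> lift equivariantly by explicit formulas. If \<open>x\<close> is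
  fixed, \<open>(z, w)\<close> is rescaled to \<open>(s z, w / s)\<close>; if \<open>r\<close> is fixed and nonzero, one of \<open>z\<close>, \<open>w\<close>
  does not vanish and keeps its phase. A small change of the real parameter at a generic value is
  realised by an \<open>x\<close>-preserving Lipschitz perturbation of the identity. It makes the real parameter
  avoid the finitely many real walls, after which \<open>x\<close> may be moved arbitrarily. Moving
  it to a complex parameter that avoids the complex walls makes every real parameter generic, and
  connectedness of \<open>\<real>\<^sup>n\<close> joins any two values.
\<close>

section \<open>Quotients by the compact torus\<close>

text \<open>Level sets are in general noncompact: (r, x) ranges over an unbounded affine space, and
  x may run to infinity past infinitely many zeros of theta. Integrating a lifted vector field would
  require completeness, so the homeomorphisms come from formulas, and the constants must be uniform
  over the base. For r a single threshold e serves, because only finitely many coordinate subspaces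
  meet an affine space. For x a continuous function M, positive on the base, takes the place of a
  threshold. This is why a merely generic value allows only moves of r: the displacement is
  Lipschitz in r with a constant independent of x, whereas in x it is just continuous. Moves of x
  wait until the real parameter alone excludes every degeneracy. The displacement then depends on r
  only, r is preserved, and the inverse is a change of sign. Walls for the real parameter have
  codimension one and can separate it into chambers, so the passage from one chamber to another goes
  through the complex parameter.\<close>

lemma openin_quotient_topology:
  assumes "equiv S r"
  shows "openin (quotient_topology X S r) U \<longleftrightarrow> U \<subseteq> S // r \<and> openin X (\<Union>U)"
proof -
  have "istopology (\<lambda>U. U \<subseteq> S // r \<and> openin X (\<Union>U))"
    unfolding istopology_def
  proof (intro conjI allI impI)
    fix U V assume U: "U \<subseteq> S // r \<and> openin X (\<Union>U)" and V: "V \<subseteq> S // r \<and> openin X (\<Union>V)"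
    \<comment> \<open>Only here do classes matter: a point lies in a single class, so two families
      covering it share that class.\<close>
    have "\<Union>(U \<inter> V) = \<Union>U \<inter> \<Union>V"
    proof (intro equalityI subsetI)
      fix x assume "x \<in> \<Union>U \<inter> \<Union>V"
      then obtain c d where "c \<in> U" "d \<in> V" "x \<in> c" "x \<in> d" by auto
      moreover have "c = d"
        using quotient_disj[OF assms, of c d] U V calculation by blast
      ultimately show "x \<in> \<Union>(U \<inter> V)" by auto
    qed auto
    then show "openin X (\<Union>(U \<inter> V))" using U V by auto
    show "U \<inter> V \<subseteq> S // r" using U by auto
  next
    fix K assume K: "\<forall>k\<in>K. k \<subseteq> S // r \<and> openin X (\<Union>k)"
    then show "\<Union>K \<subseteq> S // r" by auto
    have "\<Union>(\<Union>K) = \<Union>(Union ` K)" by auto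
    with K show "openin X (\<Union>(\<Union>K))" by auto
  qed
  then show ?thesis by (simp add: quotient_topology_def)
qed

lemma topspace_quotient_topology:
  assumes "equiv S r" "topspace X = S"
  shows "topspace (quotient_topology X S r) = S // r"
proof (intro equalityI)
  have "openin (quotient_topology X S r) (S // r)"
    using assms by (simp add: openin_quotient_topology Union_quotient openin_topspace[of X, unfolded assms(2)])
  then show "S // r \<subseteq> topspace (quotient_topology X S r)" by (rule openin_subset)
  show "topspace (quotient_topology X S r) \<subseteq> S // r"
    using openin_topspace[of "quotient_topology X S r"]
    unfolding openin_quotient_topology[OF assms(1)] by blast
qed

lemma image_equivalence_class:
  assumes S: "equiv S r" "equiv S' r'"
    and f: "f ` S \<subseteq> S'" and g: "g ` S' \<subseteq> S" and fg: "\<And>y. y \<in> S' \<Longrightarrow> f (g y) = y"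
    and rel: "\<And>x y. x \<in> S \<Longrightarrow> y \<in> S \<Longrightarrow> (x, y) \<in> r \<longleftrightarrow> (f x, f y) \<in> r'"
    and x: "x \<in> S"
  shows "f ` (r `` {x}) = r' `` {f x}"
proof (intro equalityI subsetI)
  fix y assume "y \<in> f ` (r `` {x})"
  then obtain z where "(x, z) \<in> r" "y = f z" by auto
  moreover have "z \<in> S" using S(1) calculation by (meson equiv_class_eq_iff)
  ultimately show "y \<in> r' `` {f x}" using rel x by auto
next
  fix y assume "y \<in> r' `` {f x}"
  then have y: "(f x, y) \<in> r'" by auto
  then have "y \<in> S'" using S(2) by (meson equiv_class_eq_iff)
  then have "(x, g y) \<in> r" using rel[OF x, of "g y"] fg y g by auto
  then show "y \<in> f ` (r `` {x})" using fg \<open>y \<in> S'\<close> by (metis Image_singleton_iff image_eqI)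
qed

lemma continuous_map_quotient_topology:
  assumes S: "equiv S r" "equiv S' r'" and top: "topspace X = S" "topspace X' = S'"
    and hom: "homeomorphic_maps X X' f g"
    and rel: "\<And>x y. x \<in> S \<Longrightarrow> y \<in> S \<Longrightarrow> (x, y) \<in> r \<longleftrightarrow> (f x, f y) \<in> r'"
  shows "continuous_map (quotient_topology X S r) (quotient_topology X' S' r') (image f)"
proof -
  have f: "f ` S \<subseteq> S'" and g: "g ` S' \<subseteq> S" and fg: "\<And>y. y \<in> S' \<Longrightarrow> f (g y) = y"
    and gf: "\<And>x. x \<in> S \<Longrightarrow> g (f x) = x"
    using hom top by (auto simp: homeomorphic_maps_def continuous_map_def)
  have cls: "f ` (r `` {x}) = r' `` {f x}" if "x \<in> S" for x
    using image_equivalence_class[OF S f g fg rel that] by auto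
  show ?thesis
    unfolding continuous_map topspace_quotient_topology[OF S(1) top(1)]
      topspace_quotient_topology[OF S(2) top(2)]
  proof (intro conjI allI impI subsetI)
    fix c assume "c \<in> image f ` (S // r)"
    then show "c \<in> S' // r'" using cls f by (force simp: quotient_def)
  next
    fix U assume "openin (quotient_topology X' S' r') U"
    then have U: "U \<subseteq> S' // r'" "openin X' (\<Union>U)"
      by (auto simp: openin_quotient_topology[OF S(2)])
    have "\<Union>{c \<in> S // r. f ` c \<in> U} = {x \<in> S. f x \<in> \<Union>U}"
    proof (intro equalityI subsetI)
      fix x assume "x \<in> \<Union>{c \<in> S // r. f ` c \<in> U}"
      then obtain c where "c \<in> S // r" "f ` c \<in> U" "x \<in> c" by auto
      then show "x \<in> {x \<in> S. f x \<in> \<Union>U}"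
        using Union_quotient[OF S(1)] by auto
    next
      fix x assume "x \<in> {x \<in> S. f x \<in> \<Union>U}"
      then obtain d where x: "x \<in> S" "f x \<in> d" "d \<in> U" by auto
      then have "d = r' `` {f x}"
        using U(1) S(2) by (metis quotientE subsetD Image_singleton_iff equiv_class_eq)
      then have "f ` (r `` {x}) \<in> U" using cls x by auto
      moreover have "x \<in> r `` {x}" using equiv_class_self[OF S(1) x(1)] .
      ultimately show "x \<in> \<Union>{c \<in> S // r. f ` c \<in> U}" using x by (auto intro: quotientI)
    qed
    moreover have "openin X {x \<in> S. f x \<in> \<Union>U}"
      using hom U(2) top by (auto simp: homeomorphic_maps_def continuous_map)
    ultimately show "openin (quotient_topology X S r) {c \<in> S // r. f ` c \<in> U}"
      by (auto simp: openin_quotient_topology[OF S(1)])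
  qed
qed

lemma homeomorphic_space_quotient_topology:
  assumes S: "equiv S r" "equiv S' r'" and top: "topspace X = S" "topspace X' = S'"
    and hom: "homeomorphic_maps X X' f g"
    and rel: "\<And>x y. x \<in> S \<Longrightarrow> y \<in> S \<Longrightarrow> (x, y) \<in> r \<longleftrightarrow> (f x, f y) \<in> r'"
  shows "quotient_topology X S r homeomorphic_space quotient_topology X' S' r'"
proof -
  have g: "g ` S' \<subseteq> S" and fg: "\<And>y. y \<in> S' \<Longrightarrow> f (g y) = y" and gf: "\<And>x. x \<in> S \<Longrightarrow> g (f x) = x"
    using hom top by (auto simp: homeomorphic_maps_def continuous_map_def)
  have rel': "(x, y) \<in> r' \<longleftrightarrow> (g x, g y) \<in> r" if "x \<in> S'" "y \<in> S'" for x y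
    using rel[of "g x" "g y"] g fg that by auto
  have im: "g ` f ` c = c" if "c \<in> S // r" for c
  proof -
    have "c \<subseteq> S" using that Union_quotient[OF S(1)] by auto
    then have "(\<lambda>x. g (f x)) ` c = (\<lambda>x. x) ` c" by (intro image_cong) (auto simp: gf)
    then show ?thesis by (simp add: image_image)
  qed
  have im': "f ` g ` c = c" if "c \<in> S' // r'" for c
  proof -
    have "c \<subseteq> S'" using that Union_quotient[OF S(2)] by auto
    then have "(\<lambda>x. f (g x)) ` c = (\<lambda>x. x) ` c" by (intro image_cong) (auto simp: fg)
    then show ?thesis by (simp add: image_image)
  qed
  have "homeomorphic_maps (quotient_topology X S r) (quotient_topology X' S' r') (image f) (image g)"
    unfolding homeomorphic_maps_def topspace_quotient_topology[OF S(1) top(1)]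
      topspace_quotient_topology[OF S(2) top(2)]
    using continuous_map_quotient_topology[OF S top hom rel] im im'
      continuous_map_quotient_topology[OF S(2,1) top(2,1) hom[THEN homeomorphic_maps_sym[THEN iffD1]] rel']
    by simp
  then show ?thesis by (auto simp: homeomorphic_space_def)
qed

section \<open>The group law of the compact torus and its orbit relation\<close>

lemma KR_norm: "t \<in> KR u \<Longrightarrow> cmod (t $ i) = 1"
proof -
  assume "t \<in> KR u"
  then obtain \<xi> :: "real^'a" where "t $ i = exp (2 * pi * \<i> * complex_of_real (\<xi> $ i))"
    by (auto simp: KR_def)
  then have "t $ i = exp (\<i> * complex_of_real (2 * pi * \<xi> $ i))" by (simp add: mult_ac)
  then show ?thesis by (simp only: norm_exp_i_times)
qed

lemma KR_one: "(\<chi> i. 1) \<in> KR u"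
  unfolding KR_def by (intro CollectI exI[of _ 0]) (auto simp: piu_def intro!: exI[of _ 0])

lemma piu_add: "piu u (x + y) = piu u x + piu u y"
  by (simp add: piu_def vec_eq_iff algebra_simps sum.distrib)

lemma piu_minus: "piu u (- x) = - piu u x"
  by (simp add: piu_def vec_eq_iff sum_negf)

lemma KR_mult: "s \<in> KR u \<Longrightarrow> t \<in> KR u \<Longrightarrow> (\<chi> i. s $ i * t $ i) \<in> KR u"
proof -
  assume "s \<in> KR u" "t \<in> KR u"
  then obtain \<xi> \<eta> :: "real^'a" where
    \<xi>: "\<And>i. s $ i = exp (2 * pi * \<i> * complex_of_real (\<xi> $ i))"
       "\<And>j. \<exists>m::int. piu u (\<chi> i. complex_of_real (\<xi> $ i)) $ j = of_int m" and
    \<eta>: "\<And>i. t $ i = exp (2 * pi * \<i> * complex_of_real (\<eta> $ i))"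
       "\<And>j. \<exists>m::int. piu u (\<chi> i. complex_of_real (\<eta> $ i)) $ j = of_int m"
    unfolding KR_def by blast
  have eq: "(\<chi> i. complex_of_real ((\<xi> + \<eta>) $ i)) =
      (\<chi> i. complex_of_real (\<xi> $ i)) + (\<chi> i. complex_of_real (\<eta> $ i))"
    by (simp add: vec_eq_iff)
  have "\<exists>m::int. piu u (\<chi> i. complex_of_real ((\<xi> + \<eta>) $ i)) $ j = of_int m" for j
    using \<xi>(2)[of j] \<eta>(2)[of j] unfolding eq piu_add by (metis of_int_add vector_add_component)
  moreover have "s $ i * t $ i = exp (2 * pi * \<i> * complex_of_real ((\<xi> + \<eta>) $ i))" for i
    by (simp add: \<xi>(1) \<eta>(1) exp_add[symmetric] algebra_simps)
  ultimately show ?thesis unfolding KR_def by (auto simp del: vector_add_component)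
qed

lemma KR_inverse: "t \<in> KR u \<Longrightarrow> (\<chi> i. inverse (t $ i)) \<in> KR u"
proof -
  assume "t \<in> KR u"
  then obtain \<xi> :: "real^'a" where
    \<xi>: "\<And>i. t $ i = exp (2 * pi * \<i> * complex_of_real (\<xi> $ i))"
       "\<And>j. \<exists>m::int. piu u (\<chi> i. complex_of_real (\<xi> $ i)) $ j = of_int m"
    unfolding KR_def by blast
  have eq: "(\<chi> i. complex_of_real ((- \<xi>) $ i)) = - (\<chi> i. complex_of_real (\<xi> $ i))"
    by (simp add: vec_eq_iff)
  have "\<exists>m::int. piu u (\<chi> i. complex_of_real ((- \<xi>) $ i)) $ j = of_int m" for j
    using \<xi>(2)[of j] unfolding eq piu_minus by (metis of_int_minus vector_uminus_component)
  moreover have "inverse (t $ i) = exp (2 * pi * \<i> * complex_of_real ((- \<xi>) $ i))" for i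
    by (simp add: \<xi>(1) exp_minus)
  ultimately show ?thesis unfolding KR_def by (auto simp del: vector_uminus_component)
qed

lemma act_act: "act s (act t p) = act (\<chi> i. s $ i * t $ i) p"
  by (cases p) (simp add: act_def vec_eq_iff)

lemma act_one: "act (\<chi> i. 1) p = p"
  by (cases p) (simp add: act_def vec_eq_iff)

lemma act_level:
  assumes "\<And>i. cmod (t $ i) = 1" "p \<in> level \<tau> u a b"
  shows "act t p \<in> level \<tau> u a b"
proof -
  obtain z w x where p: "p = (z, w, x)" by (cases p)
  have nz: "t $ i \<noteq> 0" for i using assms(1)[of i] by auto
  have "muR \<tau> (act t p) = muR \<tau> p"
    by (simp add: p act_def muR_def vec_eq_iff norm_mult norm_inverse assms(1))
  moreover have "muC (act t p) = muC p" by (simp add: p act_def muC_def)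
  moreover have "act t p \<in> Xn \<tau>" using assms(2) nz
    by (auto simp: p act_def Xn_def level_def field_simps)
  ultimately show ?thesis using assms(2) by (simp add: level_def)
qed

lemma equiv_orbit_rel: "equiv (level \<tau> u a b) (orbit_rel \<tau> u a b)"
proof (rule equivI)
  show "orbit_rel \<tau> u a b \<subseteq> level \<tau> u a b \<times> level \<tau> u a b" by (auto simp: orbit_rel_def)
  show "refl_on (level \<tau> u a b) (orbit_rel \<tau> u a b)"
    using KR_one by (intro refl_onI) (auto simp: orbit_rel_def act_one intro!: bexI[of _ "\<chi> i. 1"])
  show "sym (orbit_rel \<tau> u a b)"
  proof (rule symI)
    fix p q assume "(p, q) \<in> orbit_rel \<tau> u a b"
    then obtain t where t: "t \<in> KR u" "q = act t p" "p \<in> level \<tau> u a b" "q \<in> level \<tau> u a b"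
      by (auto simp: orbit_rel_def)
    have "t $ i \<noteq> 0" for i using KR_norm[OF t(1), of i] by auto
    then have "act (\<chi> i. inverse (t $ i)) q = act (\<chi> i. 1) p"
      unfolding t(2) act_act by (intro arg_cong[of _ _ "\<lambda>s. act s p"]) (simp add: vec_eq_iff)
    then have "p = act (\<chi> i. inverse (t $ i)) q" by (simp add: act_one)
    then show "(q, p) \<in> orbit_rel \<tau> u a b" using t KR_inverse[OF t(1)] unfolding orbit_rel_def by blast
  qed
  show "trans (orbit_rel \<tau> u a b)"
    by (rule transI) (auto simp: orbit_rel_def act_act intro: KR_mult)
qed

text \<open>Equivariance is asked for the whole compact torus of T, which contains
  \<open>KR u\<close>; the lifts below satisfy it there. It is asked of \<open>f\<close> only: if
  \<open>f q = f (act t p)\<close>, injectivity returns \<open>q = act t p\<close>.\<close>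

lemma Mtilde_homeomorphic_if_equivariant_homeomorphism:
  assumes "continuous_on (level \<tau> u a b) f" "continuous_on (level \<tau> u a' b') g"
    and f: "\<And>p. p \<in> level \<tau> u a b \<Longrightarrow> f p \<in> level \<tau> u a' b' \<and> g (f p) = p"
    and g: "\<And>p. p \<in> level \<tau> u a' b' \<Longrightarrow> g p \<in> level \<tau> u a b \<and> f (g p) = p"
    and eqv: "\<And>p t. p \<in> level \<tau> u a b \<Longrightarrow> (\<And>i. cmod (t $ i) = 1) \<Longrightarrow> f (act t p) = act t (f p)"
  shows "Mtilde \<tau> u a b homeomorphic_space Mtilde \<tau> u a' b'"
  unfolding Mtilde_def
proof (rule homeomorphic_space_quotient_topology[OF equiv_orbit_rel equiv_orbit_rel])
  show "homeomorphic_maps (top_of_set (level \<tau> u a b)) (top_of_set (level \<tau> u a' b')) f g"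
    using assms by (auto simp: homeomorphic_maps_def)
  fix p q assume p: "p \<in> level \<tau> u a b" and q: "q \<in> level \<tau> u a b"
  show "(p, q) \<in> orbit_rel \<tau> u a b \<longleftrightarrow> (f p, f q) \<in> orbit_rel \<tau> u a' b'"
  proof
    assume "(p, q) \<in> orbit_rel \<tau> u a b"
    then show "(f p, f q) \<in> orbit_rel \<tau> u a' b'"
      using f p q eqv KR_norm unfolding orbit_rel_def by blast
  next
    assume "(f p, f q) \<in> orbit_rel \<tau> u a' b'"
    then obtain t where t: "t \<in> KR u" "f q = act t (f p)" by (auto simp: orbit_rel_def)
    then have "f q = f (act t p)" using eqv[OF p] KR_norm by metis
    then have "q = act t p" using f q act_level[of t p] KR_norm[OF t(1)] p by metis
    then show "(p, q) \<in> orbit_rel \<tau> u a b" using p q t by (auto simp: orbit_rel_def)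
  qed
qed auto

section \<open>Relations and corrections of the parameters\<close>

text \<open>Equivalently, the vectors \<open>u i\<close> with \<open>i \<in> I\<close> are linearly independent.\<close>
definition no_relation_on :: "('n::finite \<Rightarrow> int^'d::finite) \<Rightarrow> 'n set \<Rightarrow> bool" where
  "no_relation_on u I \<longleftrightarrow> (\<forall>\<xi>\<in>kR u. (\<forall>i. i \<notin> I \<longrightarrow> \<xi> $ i = 0) \<longrightarrow> \<xi> = 0)"

lemma no_relation_on_subset: "no_relation_on u J \<Longrightarrow> I \<subseteq> J \<Longrightarrow> no_relation_on u I"
  unfolding no_relation_on_def by blast

lemma kR_iff: "\<xi> \<in> kR u \<longleftrightarrow> (\<forall>j. (\<Sum>i\<in>UNIV. \<xi> $ i * of_int (u i $ j)) = 0)"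
proof -
  have "(\<Sum>i\<in>UNIV. complex_of_real (\<xi> $ i) * of_int (u i $ j)) =
      complex_of_real (\<Sum>i\<in>UNIV. \<xi> $ i * of_int (u i $ j))" for j by simp
  then show ?thesis unfolding kR_def piu_def mem_Collect_eq vec_eq_iff
    by (simp only: vec_lambda_beta zero_index of_real_eq_0_iff)
qed

text \<open>The equations of \<open>kC u\<close> have integer coefficients, so they hold separately
  for real and imaginary parts.\<close>

lemma kC_iff: "\<zeta> \<in> kC u \<longleftrightarrow> (\<chi> i. Re (\<zeta> $ i)) \<in> kR u \<and> (\<chi> i. Im (\<zeta> $ i)) \<in> kR u"
  by (auto simp: kR_iff kC_def piu_def vec_eq_iff complex_eq_iff Re_sum Im_sum)

lemma subspace_kR: "subspace (kR u)"
  by (rule subspaceI) (auto simp: kR_iff algebra_simps sum.distrib simp flip: sum_distrib_left)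

lemma inner_vec_sum: "(a :: real^'n) \<bullet> \<xi> = (\<Sum>i\<in>UNIV. a $ i * \<xi> $ i)"
  by (simp add: inner_vec_def)

lemma iotaR_eq_inner: "iotaR_eq u a b \<longleftrightarrow> (\<forall>\<xi>\<in>kR u. a \<bullet> \<xi> = b \<bullet> \<xi>)"
  by (simp add: iotaR_eq_def inner_vec_sum)

text \<open>The orthogonal complement of the relations supported in \<open>I\<close> is the sum of the
  annihilator of all relations and of the coordinate space of the complement of \<open>I\<close>.\<close>
lemma iotaR_eq_representative_vanishing_on:
  fixes \<delta> :: "real^'n"
  assumes "\<And>\<xi>. \<xi> \<in> kR u \<Longrightarrow> (\<forall>i. i \<notin> I \<longrightarrow> \<xi> $ i = 0) \<Longrightarrow> \<delta> \<bullet> \<xi> = 0"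
  obtains s where "iotaR_eq u s \<delta>" "\<And>i. i \<in> I \<Longrightarrow> s $ i = 0"
proof -
  define E where "E = {s :: real^'n. \<forall>i\<in>I. s $ i = 0}"
  have E: "subspace E" by (rule subspaceI) (auto simp: E_def)
  define T where "T = {x + y |x y. x \<in> (kR u)\<^sup>\<bottom> \<and> y \<in> E}"
  have T: "subspace T" unfolding T_def by (rule subspace_sums[OF subspace_orthogonal_comp E])
  \<comment> \<open>The aim is \<open>v = 0\<close>, that is, \<delta> in \<open>T\<close>.
    Orthogonality to the annihilator puts \<open>v\<close> into \<open>kR u\<close> by the double
    complement, orthogonality to \<open>E\<close> confines its support to \<open>I\<close>, and the
    hypothesis then makes \<delta>, hence \<open>v\<close>, orthogonal to \<open>v\<close>.\<close>
  obtain t v where t: "t \<in> span T" and v: "\<And>w. w \<in> span T \<Longrightarrow> orthogonal v w" and \<delta>: "\<delta> = t + v"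
    using orthogonal_subspace_decomp_exists[of T \<delta>] by blast
  have tT: "t \<in> T" using t T by (simp add: span_eq_iff[THEN iffD2])
  have "x \<in> T" if "x \<in> (kR u)\<^sup>\<bottom>" for x
    unfolding T_def using that subspace_0[OF E] by (intro CollectI exI[of _ x] exI[of _ 0]) auto
  then have "v \<in> (kR u)\<^sup>\<bottom>\<^sup>\<bottom>"
    using v by (auto simp: orthogonal_comp_def span_base orthogonal_commute)
  then have vk: "v \<in> kR u" by (simp add: orthogonal_comp_self[OF subspace_kR])
  have vI: "v $ i = 0" if "i \<notin> I" for i
  proof -
    have "axis i 1 \<in> E" using that by (auto simp: E_def axis_def)
    then have "axis i 1 \<in> T" unfolding T_def using subspace_0[OF subspace_orthogonal_comp]
      by (intro CollectI exI[of _ 0] exI[of _ "axis i 1"]) auto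
    then have "orthogonal v (axis i 1)" using v by (simp add: span_base)
    then show ?thesis by (simp add: orthogonal_def inner_axis)
  qed
  have "\<delta> \<bullet> v = 0" using assms vk vI by blast
  moreover have "t \<bullet> v = 0" using v[OF t] by (simp add: orthogonal_def inner_commute)
  ultimately have "v = 0" by (simp add: \<delta> inner_add_left)
  then obtain x y where xy: "x \<in> (kR u)\<^sup>\<bottom>" "y \<in> E" "\<delta> = x + y" using tT \<delta> by (auto simp: T_def)
  show ?thesis
  proof
    show "iotaR_eq u y \<delta>" using xy
      by (auto simp: iotaR_eq_inner orthogonal_comp_def orthogonal_def inner_add_left inner_add_right inner_commute)
    show "y $ i = 0" if "i \<in> I" for i using xy(2) that by (auto simp: E_def)
  qed
qed

text \<open>If the affine space misses the subspace of vectors vanishing on \<open>J\<close>, a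
  relation supported on \<open>J\<close> separates them: its pairing is a nonzero constant on the
  affine space but small where all coordinates in \<open>J\<close> are small. There are finitely
  many \<open>J\<close>, so one \<open>e\<close> works although the affine space is unbounded. This
  extends independence from vanishing to small coordinates.\<close>

lemma small_coordinates_vanish_simultaneously:
  fixes a :: "real^'n"
  obtains e where "e > 0"
    "\<And>r. iotaR_eq u r a \<Longrightarrow> \<exists>s. iotaR_eq u s a \<and> (\<forall>i. \<bar>r $ i\<bar> < e \<longrightarrow> s $ i = 0)"
proof -
  have "\<exists>e>0. \<forall>r. iotaR_eq u r a \<longrightarrow> (\<forall>i\<in>J. \<bar>r $ i\<bar> < e) \<longrightarrow>
      (\<exists>s. iotaR_eq u s a \<and> (\<forall>i\<in>J. s $ i = 0))" for J
  proof (cases "\<exists>s. iotaR_eq u s a \<and> (\<forall>i\<in>J. s $ i = 0)")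
    case True
    then show ?thesis by (intro exI[of _ 1]) auto
  next
    case False
    then obtain \<xi> where \<xi>: "\<xi> \<in> kR u" "\<And>i. i \<notin> J \<Longrightarrow> \<xi> $ i = 0" "a \<bullet> \<xi> \<noteq> 0"
      using iotaR_eq_representative_vanishing_on[of u J a] by metis
    \<comment> \<open>The summand 1 keeps the denominator positive and makes the final estimate
      strict.\<close>
    define e where "e = \<bar>a \<bullet> \<xi>\<bar> / (1 + (\<Sum>i\<in>UNIV. \<bar>\<xi> $ i\<bar>))"
    have pos: "1 + (\<Sum>i\<in>UNIV. \<bar>\<xi> $ i\<bar>) > 0" by (simp add: add_pos_nonneg sum_nonneg)
    have "e > 0" using \<xi>(3) pos by (simp add: e_def)
    moreover have False if r: "iotaR_eq u r a" and small: "\<forall>i\<in>J. \<bar>r $ i\<bar> < e" for r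
    proof -
      have "\<bar>a \<bullet> \<xi>\<bar> = \<bar>r \<bullet> \<xi>\<bar>" using r \<xi>(1) by (simp add: iotaR_eq_inner)
      also have "\<dots> \<le> (\<Sum>i\<in>UNIV. \<bar>r $ i * \<xi> $ i\<bar>)" unfolding inner_vec_sum by (rule sum_abs)
      also have "\<dots> \<le> (\<Sum>i\<in>UNIV. e * \<bar>\<xi> $ i\<bar>)"
      proof (rule sum_mono)
        fix i show "\<bar>r $ i * \<xi> $ i\<bar> \<le> e * \<bar>\<xi> $ i\<bar>"
          using small \<xi>(2)[of i] by (cases "i \<in> J") (auto simp: abs_mult less_imp_le mult_right_mono)
      qed
      also have "\<dots> < e * (1 + (\<Sum>i\<in>UNIV. \<bar>\<xi> $ i\<bar>))"
        using \<open>e > 0\<close> by (simp add: sum_distrib_left algebra_simps)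
      also have "\<dots> = \<bar>a \<bullet> \<xi>\<bar>" using pos by (simp add: e_def)
      finally show False by simp
    qed
    ultimately show ?thesis by blast
  qed
  then obtain e where e: "\<And>J. e J > 0" "\<And>J r. iotaR_eq u r a \<Longrightarrow> (\<forall>i\<in>J. \<bar>r $ i\<bar> < e J) \<Longrightarrow>
      (\<exists>s. iotaR_eq u s a \<and> (\<forall>i\<in>J. s $ i = 0))" by metis
  have le: "Min (range e) \<le> e J" for J by simp
  show ?thesis
  proof
    show "Min (range e) > 0" using e(1) by simp
    fix r assume "iotaR_eq u r a"
    then show "\<exists>s. iotaR_eq u s a \<and> (\<forall>i. \<bar>r $ i\<bar> < Min (range e) \<longrightarrow> s $ i = 0)"
      using e(2)[of r "{i. \<bar>r $ i\<bar> < Min (range e)}"] le less_le_trans by blast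
  qed
qed

text \<open>Column \<open>j\<close> represents the functional taking \<xi> to its
  \<open>j\<close>-th coordinate by a vector vanishing on \<open>I\<close>; without relations on
  \<open>I\<close> the orthogonality condition for such a representative is vacuous. Applied to any
  \<delta>, the matrix produces a displacement with the same restriction to \<open>kR u\<close> that
  leaves the coordinates in \<open>I\<close> fixed.\<close>

lemma correction_matrix:
  assumes "no_relation_on u I"
  obtains S :: "'n::finite \<Rightarrow> 'n \<Rightarrow> real" where
    "\<And>\<xi> j. \<xi> \<in> kR u \<Longrightarrow> (\<Sum>i\<in>UNIV. \<xi> $ i * S i j) = \<xi> $ j" "\<And>i j. i \<in> I \<Longrightarrow> S i j = 0"
proof -
  have "\<exists>s. iotaR_eq u s (axis j 1) \<and> (\<forall>i\<in>I. s $ i = 0)" for j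
    using assms iotaR_eq_representative_vanishing_on[of u I "axis j 1"]
    unfolding no_relation_on_def by (metis inner_zero_right)
  then obtain s where s: "\<And>j. iotaR_eq u (s j) (axis j 1)" "\<And>i j. i \<in> I \<Longrightarrow> s j $ i = 0" by metis
  show ?thesis
  proof (rule that[of "\<lambda>i j. s j $ i"])
    fix \<xi> j assume "\<xi> \<in> kR u"
    then have "s j \<bullet> \<xi> = axis j 1 \<bullet> \<xi>" using s(1) by (simp add: iotaR_eq_inner)
    then have "s j \<bullet> \<xi> = \<xi> $ j" by (simp add: inner_axis')
    then show "(\<Sum>i\<in>UNIV. \<xi> $ i * s j $ i) = \<xi> $ j"
      by (simp add: inner_vec_sum mult.commute)
  qed (use s in auto)
qed

text \<open>The terms in the expansion of the product of all \<open>(1 - G $ i) + G $ i\<close>,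
  hence a partition of unity indexed by subsets. For \<open>G\<close> in the unit cube it is the
  probability that independent events with probabilities \<open>G $ i\<close> fail exactly on
  \<open>I\<close>.\<close>

definition subset_weight :: "real^'n::finite \<Rightarrow> 'n set \<Rightarrow> real" where
  "subset_weight G I = (\<Prod>i\<in>I. 1 - G $ i) * (\<Prod>i\<in>- I. G $ i)"

lemma sum_subset_weight: "(\<Sum>I\<in>UNIV. subset_weight G I) = 1"
  using prod_add[of UNIV "\<lambda>i. 1 - G $ i" "\<lambda>i. G $ i"] by (simp add: subset_weight_def Compl_eq_Diff_UNIV)

lemma subset_weight_eq_prod: "subset_weight G I = (\<Prod>i\<in>UNIV. if i \<in> I then 1 - G $ i else G $ i)"
  unfolding subset_weight_def by (subst prod.If_cases) (auto simp: Collect_neg_eq)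

lemma subset_weight_lipschitz:
  assumes "\<And>i. G $ i \<in> {0..1}" "\<And>i. G' $ i \<in> {0..1}"
  shows "\<bar>subset_weight G I - subset_weight G' I\<bar> \<le> (\<Sum>i\<in>UNIV. \<bar>G $ i - G' $ i\<bar>)"
proof -
  have "\<bar>subset_weight G I - subset_weight G' I\<bar> \<le> (\<Sum>i\<in>UNIV.
      norm ((if i \<in> I then 1 - G $ i else G $ i) - (if i \<in> I then 1 - G' $ i else G' $ i)))"
    unfolding subset_weight_eq_prod real_norm_def[symmetric]
    by (rule norm_prod_diff) (use assms in auto)
  also have "\<dots> = (\<Sum>i\<in>UNIV. \<bar>G $ i - G' $ i\<bar>)" by (rule sum.cong) auto
  finally show ?thesis .
qed

lemma subset_weight_bounded:
  assumes "\<And>i. G $ i \<in> {0..1}"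
  shows "\<bar>subset_weight G I\<bar> \<le> 1"
  unfolding subset_weight_eq_prod abs_prod by (rule prod_le_1) (use assms in auto)

text \<open>The averages of the correction matrices with the weights \<^const>\<open>subset_weight\<close>: only
  matrices for sets \<open>I\<close> with \<open>G < 1\<close> on \<open>I\<close> and \<open>G > 0\<close> off \<open>I\<close> contribute.\<close>
lemma correction_matrix_family:
  obtains D :: "real^'n::finite \<Rightarrow> 'n \<Rightarrow> 'n \<Rightarrow> real" and C :: real where "C > 0"
    "\<And>G \<xi> j. no_relation_on u {i. G $ i \<noteq> 1} \<Longrightarrow> \<xi> \<in> kR u \<Longrightarrow> (\<Sum>i\<in>UNIV. \<xi> $ i * D G i j) = \<xi> $ j"
    "\<And>G i j. G $ i = 0 \<Longrightarrow> D G i j = 0"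
    "\<And>G i j. \<forall>i. G $ i \<in> {0..1} \<Longrightarrow> \<bar>D G i j\<bar> \<le> C"
    "\<And>G G' i j. \<forall>i. G $ i \<in> {0..1} \<Longrightarrow> \<forall>i. G' $ i \<in> {0..1} \<Longrightarrow>
       \<bar>D G i j - D G' i j\<bar> \<le> C * (\<Sum>k\<in>UNIV. \<bar>G $ k - G' $ k\<bar>)"
    "\<And>i j. continuous_on UNIV (\<lambda>G. D G i j)"
proof -
  have "\<exists>S. no_relation_on u I \<longrightarrow> (\<forall>\<xi>\<in>kR u. \<forall>j. (\<Sum>i\<in>UNIV. \<xi> $ i * S i j) = \<xi> $ j) \<and>
      (\<forall>i\<in>I. \<forall>j. S i j = (0::real))" for I :: "'n set"
    using correction_matrix[of u I] by metis
  then obtain S :: "'n set \<Rightarrow> 'n \<Rightarrow> 'n \<Rightarrow> real" where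
    S: "\<And>I \<xi> j. no_relation_on u I \<Longrightarrow> \<xi> \<in> kR u \<Longrightarrow> (\<Sum>i\<in>UNIV. \<xi> $ i * S I i j) = \<xi> $ j"
       "\<And>I i j. no_relation_on u I \<Longrightarrow> i \<in> I \<Longrightarrow> S I i j = 0" by metis
  define Q where "Q = {I. no_relation_on u I}"
  define D where "D = (\<lambda>G i j. \<Sum>I\<in>Q. subset_weight G I * S I i j)"
  define C where "C = 1 + (\<Sum>i\<in>UNIV. \<Sum>j\<in>UNIV. \<Sum>I\<in>UNIV. \<bar>S I i j\<bar>)"
  have C: "(\<Sum>I\<in>Q. \<bar>S I i j\<bar>) \<le> C" for i j
  proof -
    have "(\<Sum>I\<in>Q. \<bar>S I i j\<bar>) \<le> (\<Sum>I\<in>UNIV. \<bar>S I i j\<bar>)" by (rule sum_mono2) auto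
    also have "\<dots> \<le> (\<Sum>j\<in>UNIV. \<Sum>I\<in>UNIV. \<bar>S I i j\<bar>)"
      by (rule member_le_sum) (auto intro: sum_nonneg)
    also have "\<dots> \<le> (\<Sum>i\<in>UNIV. \<Sum>j\<in>UNIV. \<Sum>I\<in>UNIV. \<bar>S I i j\<bar>)"
      by (rule member_le_sum[of i UNIV "\<lambda>i. \<Sum>j\<in>UNIV. \<Sum>I\<in>UNIV. \<bar>S I i j\<bar>"]) (auto intro: sum_nonneg)
    finally show ?thesis by (simp add: C_def)
  qed
  show ?thesis
  proof
    show "C > 0" unfolding C_def by (intro add_pos_nonneg sum_nonneg) auto
    fix G :: "real^'n" and \<xi> j
    assume G: "no_relation_on u {i. G $ i \<noteq> 1}" and \<xi>: "\<xi> \<in> kR u"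
    \<comment> \<open>A set outside \<open>Q\<close> carries a relation, so it contains some
      \<open>i\<close> with \<open>G $ i = 1\<close>, and the factor \<open>1 - G $ i\<close> kills
      its weight. Restricting the sum to \<open>Q\<close> therefore loses no mass.\<close>
    have zero: "subset_weight G I = 0" if "I \<notin> Q" for I
    proof -
      have "\<not> I \<subseteq> {i. G $ i \<noteq> 1}" using that no_relation_on_subset[OF G] by (auto simp: Q_def)
      then obtain i where "i \<in> I" "G $ i = 1" by auto
      then have "(\<Prod>i\<in>I. 1 - G $ i) = 0" by (intro prod_zero) (auto intro!: bexI[of _ i])
      then show ?thesis by (simp add: subset_weight_def)
    qed
    have "(\<Sum>i\<in>UNIV. \<xi> $ i * D G i j) = (\<Sum>I\<in>Q. subset_weight G I * (\<Sum>i\<in>UNIV. \<xi> $ i * S I i j))"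
      unfolding D_def sum_distrib_left by (subst sum.swap) (simp add: mult_ac)
    also have "\<dots> = (\<Sum>I\<in>Q. subset_weight G I * \<xi> $ j)"
      by (intro sum.cong refl) (auto simp: Q_def S(1) \<xi>)
    also have "\<dots> = (\<Sum>I\<in>UNIV. subset_weight G I) * \<xi> $ j"
      unfolding sum_distrib_right by (rule sum.mono_neutral_left) (auto simp: zero)
    finally show "(\<Sum>i\<in>UNIV. \<xi> $ i * D G i j) = \<xi> $ j" by (simp add: sum_subset_weight)
  next
    fix G :: "real^'n" and i j assume "G $ i = 0"
    \<comment> \<open>Row \<open>i\<close> of the matrix vanishes if \<open>i\<close> is in
      \<open>I\<close>; otherwise the weight contains the factor \<open>G $ i\<close>.\<close>
    then have "subset_weight G I * S I i j = 0" if "I \<in> Q" for I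
      using that S(2)[of I i j] by (cases "i \<in> I") (auto simp: Q_def subset_weight_def intro!: prod_zero)
    then show "D G i j = 0" unfolding D_def by (intro sum.neutral) auto
  next
    fix G :: "real^'n" and i j assume "\<forall>i. G $ i \<in> {0..1}"
    then have G: "\<And>i. G $ i \<in> {0..1}" by blast
    have "\<bar>D G i j\<bar> \<le> (\<Sum>I\<in>Q. \<bar>subset_weight G I * S I i j\<bar>)" unfolding D_def by (rule sum_abs)
    also have "\<dots> \<le> (\<Sum>I\<in>Q. 1 * \<bar>S I i j\<bar>)" unfolding abs_mult
      by (intro sum_mono mult_right_mono subset_weight_bounded G) auto
    also have "\<dots> \<le> C" using C by simp
    finally show "\<bar>D G i j\<bar> \<le> C" .
  next
    fix G G' :: "real^'n" and i j assume "\<forall>i. G $ i \<in> {0..1}" "\<forall>i. G' $ i \<in> {0..1}"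
    then have G: "\<And>i. G $ i \<in> {0..1}" "\<And>i. G' $ i \<in> {0..1}" by blast+
    have "\<bar>D G i j - D G' i j\<bar> \<le> (\<Sum>I\<in>Q. \<bar>subset_weight G I - subset_weight G' I\<bar> * \<bar>S I i j\<bar>)"
      unfolding D_def sum_subtractf[symmetric] left_diff_distrib[symmetric] abs_mult[symmetric]
      by (rule sum_abs)
    also have "\<dots> \<le> (\<Sum>I\<in>Q. (\<Sum>k\<in>UNIV. \<bar>G $ k - G' $ k\<bar>) * \<bar>S I i j\<bar>)"
      by (intro sum_mono mult_right_mono subset_weight_lipschitz G) auto
    also have "\<dots> = (\<Sum>I\<in>Q. \<bar>S I i j\<bar>) * (\<Sum>k\<in>UNIV. \<bar>G $ k - G' $ k\<bar>)"
      by (simp add: sum_distrib_right mult.commute[of "\<bar>S _ i j\<bar>"])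
    also have "\<dots> \<le> C * (\<Sum>k\<in>UNIV. \<bar>G $ k - G' $ k\<bar>)"
      by (intro mult_right_mono C sum_nonneg) auto
    finally show "\<bar>D G i j - D G' i j\<bar> \<le> C * (\<Sum>k\<in>UNIV. \<bar>G $ k - G' $ k\<bar>)" .
  next
    fix i j show "continuous_on UNIV (\<lambda>G. D G i j)"
      unfolding D_def subset_weight_def by (intro continuous_intros)
  qed
qed

section \<open>Zeros of the theta function and transversal parameters\<close>

lemma norm_nome_less_1:
  assumes "Im \<tau> > 0"
  shows "norm (nome \<tau>) < 1"
  using assms by (simp add: nome_def)

definition theta_factor :: "complex \<Rightarrow> nat \<Rightarrow> complex \<Rightarrow> complex" where
  "theta_factor \<tau> m x = (1 - nome \<tau> ^ Suc m * exp (2 * pi * \<i> * x)) *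
     (1 - nome \<tau> ^ Suc m * exp (- 2 * pi * \<i> * x))"

lemma theta_eq_prodinf_factor:
  "theta \<tau> x = (exp (pi * \<i> * x) - exp (- pi * \<i> * x)) * prodinf (\<lambda>m. theta_factor \<tau> m x)"
  by (simp add: theta_def theta_factor_def)

text \<open>A geometric majorant depending on \<open>x\<close> only through \<open>B\<close>: it
  gives absolute convergence at a point and, with \<open>B\<close> chosen on a compact ball, uniform
  convergence there.\<close>

lemma theta_factor_bound:
  assumes "Im \<tau> > 0" "norm (exp (2 * pi * \<i> * x)) \<le> B" "norm (exp (- 2 * pi * \<i> * x)) \<le> B"
  shows "norm (theta_factor \<tau> m x - 1) \<le> (2 * B + B\<^sup>2) * norm (nome \<tau>) ^ m"
proof -
  define Q where "Q = norm (nome \<tau>) ^ m"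
  define s t where "s = exp (2 * pi * \<i> * x)" and "t = exp (- 2 * pi * \<i> * x)"
  define q where "q = nome \<tau> ^ Suc m"
  have n: "norm (nome \<tau>) \<le> 1" using norm_nome_less_1[OF assms(1)] by simp
  have B: "B \<ge> 0" using assms(2) norm_ge_zero order_trans by blast
  have Q: "0 \<le> Q" "Q \<le> 1" using n by (auto simp: Q_def power_le_one)
  have qQ: "norm q \<le> Q"
    using mult_right_mono[OF n, of "norm (nome \<tau>) ^ m"] by (simp add: q_def Q_def norm_power norm_mult)
  have "theta_factor \<tau> m x - 1 = - (q * s) - q * t + (q * s) * (q * t)"
    by (simp add: theta_factor_def s_def t_def q_def algebra_simps)
  also have "norm \<dots> \<le> norm (q * s) + norm (q * t) + norm ((q * s) * (q * t))"
    by (metis (no_types, opaque_lifting) norm_minus_cancel norm_triangle_ineq norm_triangle_ineq4 add_right_mono order_trans)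
  also have "\<dots> \<le> Q * B + Q * B + (Q * B) * (Q * B)"
    using assms(2,3) B Q qQ unfolding norm_mult s_def t_def
    by (intro add_mono mult_mono) auto
  also have "\<dots> \<le> Q * B + Q * B + Q * (B * B)"
  proof -
    have "Q * (Q * (B * B)) \<le> 1 * (Q * (B * B))" using Q B by (intro mult_right_mono) auto
    then show ?thesis by (simp add: mult_ac)
  qed
  finally show ?thesis by (simp add: Q_def power2_eq_square algebra_simps)
qed

lemma theta_factor_summable:
  assumes "Im \<tau> > 0"
  shows "summable (\<lambda>m. norm (theta_factor \<tau> m x - 1))"
proof -
  define B where "B = max (norm (exp (2 * pi * \<i> * x))) (norm (exp (- 2 * pi * \<i> * x)))"
  have "summable (\<lambda>m. (2 * B + B\<^sup>2) * norm (nome \<tau>) ^ m)"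
    using norm_nome_less_1[OF assms] by (intro summable_mult summable_geometric) auto
  then show ?thesis
    by (rule summable_comparison_test')
      (use theta_factor_bound[OF assms, of x B] in \<open>auto simp: B_def\<close>)
qed

lemma convergent_prod_theta_factor:
  assumes "Im \<tau> > 0"
  shows "convergent_prod (\<lambda>m. theta_factor \<tau> m x)"
  using theta_factor_summable[OF assms, of x]
  by (intro abs_convergent_prod_imp_convergent_prod summable_imp_abs_convergent_prod)

lemma continuous_prodinf_theta_factor:
  assumes "Im \<tau> > 0"
  shows "continuous_on UNIV (\<lambda>x. prodinf (\<lambda>m. theta_factor \<tau> m x))"
proof -
  have on: "continuous_on (cball 0 R) (\<lambda>x. prodinf (\<lambda>m. theta_factor \<tau> m x))" for R
  proof -
    have cont: "continuous_on A (theta_factor \<tau> m)" for m A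
      unfolding theta_factor_def by (intro continuous_intros)
    have "compact ((\<lambda>x. exp (2 * pi * \<i> * x)) ` cball 0 R)" "compact ((\<lambda>x. exp (- 2 * pi * \<i> * x)) ` cball 0 R)"
      by (intro compact_continuous_image continuous_intros compact_cball)+
    then obtain B1 B2 where "\<And>x. x \<in> cball 0 R \<Longrightarrow> norm (exp (2 * pi * \<i> * x)) \<le> B1"
      "\<And>x. x \<in> cball 0 R \<Longrightarrow> norm (exp (- 2 * pi * \<i> * x)) \<le> B2"
      by (metis compact_imp_bounded bounded_iff imageI)
    then have B: "norm (exp (2 * pi * \<i> * x)) \<le> max B1 B2" "norm (exp (- 2 * pi * \<i> * x)) \<le> max B1 B2"
      if "x \<in> cball 0 R" for x using that by (auto intro: max.coboundedI1 max.coboundedI2)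
    let ?B = "max B1 B2"
    have "uniformly_convergent_on (cball 0 R) (\<lambda>N x. \<Sum>n<N. norm (theta_factor \<tau> n x - 1))"
    proof (rule Weierstrass_m_test'_ev)
      show "\<forall>\<^sub>F n in sequentially. \<forall>x\<in>cball 0 R. norm (norm (theta_factor \<tau> n x - 1)) \<le>
          (2 * ?B + ?B\<^sup>2) * norm (nome \<tau>) ^ n"
        using theta_factor_bound[OF assms B] by (intro always_eventually) auto
      show "summable (\<lambda>n. (2 * ?B + ?B\<^sup>2) * norm (nome \<tau>) ^ n)"
        using norm_nome_less_1[OF assms] by (intro summable_mult summable_geometric) auto
    qed
    then have "uniformly_convergent_on (cball 0 R) (\<lambda>N x. \<Prod>n<N. theta_factor \<tau> n x)"
      by (intro uniformly_convergent_on_prod' cont compact_cball)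
    then obtain l where l: "uniform_limit (cball 0 R) (\<lambda>N x. \<Prod>n<N. theta_factor \<tau> n x) l sequentially"
      by (auto simp: uniformly_convergent_on_def)
    have "continuous_on (cball 0 R) l"
      by (rule uniform_limit_theorem[OF _ l])
        (auto intro!: always_eventually continuous_on_prod cont)
    moreover have "l x = prodinf (\<lambda>m. theta_factor \<tau> m x)" if "x \<in> cball 0 R" for x
    proof -
      have "(\<lambda>N. \<Prod>n<N. theta_factor \<tau> n x) \<longlonglongrightarrow> l x" using tendsto_uniform_limitI[OF l that] .
      \<comment> \<open>The limit that characterises \<open>prodinf\<close> runs over
        \<open>n \<le> N\<close>, hence the shift by one.\<close>
      then have "(\<lambda>N. \<Prod>n<Suc N. theta_factor \<tau> n x) \<longlonglongrightarrow> l x" by (rule LIMSEQ_Suc)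
      then have "(\<lambda>N. \<Prod>n\<le>N. theta_factor \<tau> n x) \<longlonglongrightarrow> l x" by (simp add: lessThan_Suc_atMost)
      then show ?thesis using convergent_prod_LIMSEQ[OF convergent_prod_theta_factor[OF assms]] LIMSEQ_unique by blast
    qed
    ultimately show ?thesis by (rule continuous_on_eq)
  qed
  have "isCont (\<lambda>x. prodinf (\<lambda>m. theta_factor \<tau> m x)) x" for x
    using on[of "norm x + 1"] by (intro continuous_on_interior) (auto simp: interior_cball)
  then show ?thesis by (simp add: continuous_at_imp_continuous_on)
qed

lemma continuous_on_theta:
  assumes "Im \<tau> > 0" "continuous_on A f"
  shows "continuous_on A (\<lambda>p. theta \<tau> (f p))"
proof -
  have "continuous_on UNIV (theta \<tau>)"
    unfolding theta_eq_prodinf_factor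
    by (intro continuous_intros continuous_prodinf_theta_factor assms)
  then show ?thesis using assms(2) by (rule continuous_on_compose2) auto
qed

lemma countable_exp_linear_eq:
  assumes "c \<noteq> 0"
  shows "countable {x. exp (c * x) = (y::complex)}"
proof (cases "y = 0")
  case False
  have "{x. exp (c * x) = y} \<subseteq> range (\<lambda>n::int. (Ln y + 2 * of_int n * pi * \<i>) / c)"
  proof
    fix x assume "x \<in> {x. exp (c * x) = y}"
    then have "exp (c * x) = exp (Ln y)" using False by simp
    then obtain n :: int where "c * x = Ln y + (of_int (2 * n) * pi) * \<i>" by (auto simp: exp_eq)
    then have "x = (Ln y + 2 * of_int n * pi * \<i>) / c" using assms by (simp add: field_simps)
    then show "x \<in> range (\<lambda>n::int. (Ln y + 2 * of_int n * pi * \<i>) / c)" by auto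
  qed
  then show ?thesis by (rule countable_subset) auto
qed auto

text \<open>A convergent infinite product vanishes only if one of its factors does, so every zero
  solves one of countably many equations \<open>exp (c * x) = y\<close>.\<close>

lemma countable_theta_zeros:
  assumes "Im \<tau> > 0"
  shows "countable {x. theta \<tau> x = 0}"
proof -
  have fac: "countable {x. theta_factor \<tau> m x = 0}" for m
  proof (rule countable_subset)
    have q: "nome \<tau> ^ Suc m \<noteq> 0" by (simp add: nome_def)
    show "{x. theta_factor \<tau> m x = 0} \<subseteq> {x. exp ((2 * pi * \<i>) * x) = inverse (nome \<tau> ^ Suc m)} \<union>
        {x. exp ((- 2 * pi * \<i>) * x) = inverse (nome \<tau> ^ Suc m)}"
    proof
      fix x assume "x \<in> {x. theta_factor \<tau> m x = 0}"
      then have "nome \<tau> ^ Suc m * exp (2 * pi * \<i> * x) = 1 \<or> nome \<tau> ^ Suc m * exp (- 2 * pi * \<i> * x) = 1"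
        unfolding theta_factor_def by (auto simp del: power_Suc)
      then show "x \<in> {x. exp ((2 * pi * \<i>) * x) = inverse (nome \<tau> ^ Suc m)} \<union>
        {x. exp ((- 2 * pi * \<i>) * x) = inverse (nome \<tau> ^ Suc m)}"
        using inverse_unique by (metis (mono_tags, lifting) UnI1 UnI2 mem_Collect_eq)
    qed
    show "countable ({x. exp ((2 * pi * \<i>) * x) = inverse (nome \<tau> ^ Suc m)} \<union>
        {x. exp ((- 2 * pi * \<i>) * x) = inverse (nome \<tau> ^ Suc m)})"
      by (intro countable_Un countable_exp_linear_eq) auto
  qed
  have "{x. theta \<tau> x = 0} \<subseteq> {x. exp ((2 * pi * \<i>) * x) = 1} \<union> (\<Union>m. {x. theta_factor \<tau> m x = 0})"
  proof
    fix x assume "x \<in> {x. theta \<tau> x = 0}"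
    then consider "exp (pi * \<i> * x) = exp (- pi * \<i> * x)" | "prodinf (\<lambda>m. theta_factor \<tau> m x) = 0"
      by (auto simp: theta_eq_prodinf_factor)
    then show "x \<in> {x. exp ((2 * pi * \<i>) * x) = 1} \<union> (\<Union>m. {x. theta_factor \<tau> m x = 0})"
    proof cases
      case 1
      have "exp ((2 * pi * \<i>) * x) = exp (pi * \<i> * x) * exp (pi * \<i> * x)"
        by (simp add: exp_add[symmetric] mult_ac)
      also have "\<dots> = exp (pi * \<i> * x) * exp (- (pi * \<i> * x))" using 1 by simp
      also have "\<dots> = 1" by (simp add: exp_minus)
      finally show ?thesis by auto
    next
      case 2
      then show ?thesis
        using prodinf_nonzero[OF convergent_prod_theta_factor[OF assms, of x]] by auto
    qed
  qed
  moreover have "countable ({x. exp ((2 * pi * \<i>) * x) = 1} \<union> (\<Union>m. {x. theta_factor \<tau> m x = 0}))"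
    by (intro countable_Un countable_exp_linear_eq countable_UN fac) auto
  ultimately show ?thesis by (rule countable_subset)
qed

section \<open>Parameters off the walls\<close>

lemma avoid_countably_many_hyperplanes:
  fixes \<xi> :: "'i \<Rightarrow> real^'n::finite"
  assumes "countable K" "\<And>k. k \<in> K \<Longrightarrow> \<xi> k \<noteq> 0" "\<And>k. k \<in> K \<Longrightarrow> countable (N k)" "e > 0"
  obtains b where "dist a b < e" "\<And>k. k \<in> K \<Longrightarrow> \<xi> k \<bullet> b \<notin> N k"
proof -
  define \<F> where "\<F> = (\<lambda>(k, c). {b. \<xi> k \<bullet> b = c}) ` (SIGMA k:K. N k)"
  \<comment> \<open>Countably many hyperplanes have measure zero and cannot cover a ball.\<close>
  have "negligible (\<Union>\<F>)"
  proof (rule negligible_countable_Union)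
    show "countable \<F>" unfolding \<F>_def using assms by (intro countable_image countable_SIGMA) auto
    show "negligible S" if "S \<in> \<F>" for S
      using that assms(2) by (auto simp: \<F>_def intro!: negligible_hyperplane)
  qed
  moreover have "\<not> negligible (ball a e)"
    using open_not_negligible[of "ball a e"] \<open>e > 0\<close> by auto
  ultimately obtain b where "b \<in> ball a e" "b \<notin> \<Union>\<F>" using negligible_subset by blast
  then show ?thesis using that[of b] by (auto simp: \<F>_def)
qed

text \<open>Independence enforced by the zeros of r alone, whatever the complex parameter is. In
  \<open>transversal_C\<close> the zeros of theta enforce it alone, whatever the real parameter
  is.\<close>

definition transversal_R :: "('n::finite \<Rightarrow> int^'d::finite) \<Rightarrow> real^'n \<Rightarrow> bool" where
  "transversal_R u a \<longleftrightarrow> (\<forall>r. iotaR_eq u r a \<longrightarrow> no_relation_on u {i. r $ i = 0})"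

definition transversal_C :: "complex \<Rightarrow> ('n::finite \<Rightarrow> int^'d::finite) \<Rightarrow> complex^'n \<Rightarrow> bool" where
  "transversal_C \<tau> u b \<longleftrightarrow>
     (\<forall>x. iotaC_eq u x b \<longrightarrow> no_relation_on u {i. theta \<tau> (x $ i) = 0})"

lemma relation_family:
  obtains \<xi> :: "'n::finite set \<Rightarrow> real^'n" where
    "\<And>J. \<not> no_relation_on u J \<Longrightarrow> \<xi> J \<in> kR u \<and> \<xi> J \<noteq> 0 \<and> (\<forall>i. i \<notin> J \<longrightarrow> \<xi> J $ i = 0)"
proof -
  have "\<forall>J. \<exists>\<xi>. \<not> no_relation_on u J \<longrightarrow> \<xi> \<in> kR u \<and> \<xi> \<noteq> 0 \<and> (\<forall>i. i \<notin> J \<longrightarrow> \<xi> $ i = 0)"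
    unfolding no_relation_on_def by blast
  then show ?thesis using that by metis
qed

text \<open>One relation per dependent set \<open>J\<close> suffices: if some \<open>r\<close> in
  the class of \<open>b\<close> vanishes on \<open>J\<close>, the relation pairs to zero with
  \<open>r\<close> and hence with \<open>b\<close>. The walls are thus contained in finitely many
  hyperplanes.\<close>

lemma transversal_R_dense:
  assumes "e > 0"
  obtains b where "dist a b < e" "transversal_R u b"
proof -
  obtain \<xi> :: "'a set \<Rightarrow> real^'a" where
    \<xi>: "\<And>J. \<not> no_relation_on u J \<Longrightarrow> \<xi> J \<in> kR u \<and> \<xi> J \<noteq> 0 \<and> (\<forall>i. i \<notin> J \<longrightarrow> \<xi> J $ i = 0)"
    using relation_family by metis
  obtain b where b: "dist a b < e" "\<And>J. J \<in> {J. \<not> no_relation_on u J} \<Longrightarrow> \<xi> J \<bullet> b \<notin> {0}"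
    by (rule avoid_countably_many_hyperplanes[of "{J. \<not> no_relation_on u J}" \<xi> "\<lambda>_. {0}" e a])
      (use assms \<xi> in \<open>auto intro: countable_finite\<close>)
  have "no_relation_on u {i. r $ i = 0}" if r: "iotaR_eq u r b" for r
  proof (rule ccontr)
    assume J: "\<not> no_relation_on u {i. r $ i = 0}"
    have "\<xi> {i. r $ i = 0} \<bullet> b = \<xi> {i. r $ i = 0} \<bullet> r"
      using r \<xi>[OF J] by (auto simp: iotaR_eq_inner inner_commute)
    also have "\<dots> = 0" unfolding inner_vec_sum using \<xi>[OF J] by (intro sum.neutral) auto
    finally show False using b(2) J by auto
  qed
  then show ?thesis using b that by (auto simp: transversal_R_def)
qed

text \<open>The witness is a real vector \<open>b\<close>. A real relation \<xi> supported on
  \<open>J\<close> sees only the coordinates of \<open>x\<close> in \<open>J\<close>; if these are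
  zeros of theta, the pairing of \<xi> with \<open>b\<close> is the real part of one of countably
  many numbers.\<close>

lemma transversal_C_exists:
  assumes "Im \<tau> > 0"
  obtains b where "transversal_C \<tau> u b"
proof -
  obtain \<xi> :: "'a set \<Rightarrow> real^'a" where
    \<xi>: "\<And>J. \<not> no_relation_on u J \<Longrightarrow> \<xi> J \<in> kR u \<and> \<xi> J \<noteq> 0 \<and> (\<forall>i. i \<notin> J \<longrightarrow> \<xi> J $ i = 0)"
    using relation_family by metis
  \<comment> \<open>The value 0 is adjoined as the filler for coordinates outside \<open>J\<close>,
    which a relation supported on \<open>J\<close> does not see.\<close>
  define Z where "Z = insert 0 {x. theta \<tau> x = 0}"
  define V where "V = {x :: complex^'a. \<forall>i. x $ i \<in> Z}"
  have "countable (PiE (UNIV :: 'a set) (\<lambda>_. Z))"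
    using countable_theta_zeros[OF assms] by (intro countable_PiE) (auto simp: Z_def)
  then have "countable (vec_lambda ` PiE (UNIV :: 'a set) (\<lambda>_. Z))" by (rule countable_image)
  moreover have "V \<subseteq> vec_lambda ` PiE (UNIV :: 'a set) (\<lambda>_. Z)"
  proof
    fix x assume "x \<in> V"
    then have "x = vec_lambda (\<lambda>i. x $ i)" "(\<lambda>i. x $ i) \<in> PiE UNIV (\<lambda>_. Z)" by (auto simp: V_def)
    then show "x \<in> vec_lambda ` PiE UNIV (\<lambda>_. Z)" by blast
  qed
  ultimately have V: "countable V" by (rule countable_subset[rotated])
  define N where "N = (\<lambda>J. (\<lambda>x. Re (\<Sum>i\<in>UNIV. x $ i * \<xi> J $ i)) ` V)"
  obtain b where b: "\<And>J. J \<in> {J. \<not> no_relation_on u J} \<Longrightarrow> \<xi> J \<bullet> b \<notin> N J"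
    by (rule avoid_countably_many_hyperplanes[of "{J. \<not> no_relation_on u J}" \<xi> N 1 0])
      (use \<xi> V in \<open>auto simp: N_def intro: countable_finite\<close>)
  have "no_relation_on u {i. theta \<tau> (x $ i) = 0}"
    if x: "iotaC_eq u x (\<chi> i. complex_of_real (b $ i))" for x
  proof (rule ccontr)
    define J where "J = {i. theta \<tau> (x $ i) = 0}"
    assume "\<not> no_relation_on u {i. theta \<tau> (x $ i) = 0}"
    then have J: "\<not> no_relation_on u J" by (simp add: J_def)
    have "(\<chi> i. complex_of_real (\<xi> J $ i)) \<in> kC u"
      using \<xi>[OF J] by (auto simp: kC_iff kR_iff)
    then have "(\<Sum>i\<in>UNIV. x $ i * \<xi> J $ i) = (\<Sum>i\<in>UNIV. complex_of_real (b $ i) * \<xi> J $ i)"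
      using x unfolding iotaC_eq_def by fastforce
    also have "\<dots> = complex_of_real (\<xi> J \<bullet> b)" by (simp add: inner_vec_sum mult.commute)
    finally have "\<xi> J \<bullet> b = Re (\<Sum>i\<in>UNIV. x $ i * \<xi> J $ i)" by simp
    also have "(\<Sum>i\<in>UNIV. x $ i * \<xi> J $ i) = (\<Sum>i\<in>UNIV. (\<chi> i. if i \<in> J then x $ i else 0) $ i * \<xi> J $ i)"
      using \<xi>[OF J] by (intro sum.cong) auto
    finally have "\<xi> J \<bullet> b = Re (\<Sum>i\<in>UNIV. (\<chi> i. if i \<in> J then x $ i else 0) $ i * \<xi> J $ i)" .
    moreover have "(\<chi> i. if i \<in> J then x $ i else 0) \<in> V" by (simp add: V_def Z_def J_def)
    ultimately have "\<xi> J \<bullet> b \<in> N J" unfolding N_def by (rule image_eqI)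
    then show False using b J by auto
  qed
  then show ?thesis using that by (auto simp: transversal_C_def)
qed

section \<open>Lifting displacements of the base\<close>

definition fibre_weight :: "complex \<Rightarrow> complex \<Rightarrow> real" where
  "fibre_weight \<tau> x = exp (- 2 * pi * (Im x)\<^sup>2 / Im \<tau>)"

definition moment :: "complex \<Rightarrow> complex \<Rightarrow> complex \<Rightarrow> complex \<Rightarrow> real" where
  "moment \<tau> z w x = (1/2) * ((cmod z)\<^sup>2 - fibre_weight \<tau> x * (cmod w)\<^sup>2)"

text \<open>On \<open>z * w = theta \<tau> x\<close> with \<open>r = moment \<tau> z w x\<close> this is half the weighted squared norm of \<open>(z, w)\<close>.\<close>
definition radius :: "complex \<Rightarrow> real \<Rightarrow> complex \<Rightarrow> real" where
  "radius \<tau> r x = sqrt (r\<^sup>2 + fibre_weight \<tau> x * (cmod (theta \<tau> x))\<^sup>2)"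

lemma fibre_weight_pos [simp]: "fibre_weight \<tau> x > 0"
  by (simp add: fibre_weight_def)

lemma fibre_weight_nonzero [simp]: "fibre_weight \<tau> x \<noteq> 0"
  using fibre_weight_pos[of \<tau> x] by linarith

lemma fibre_weight_nonneg [simp]: "fibre_weight \<tau> x \<ge> 0"
  by (simp add: fibre_weight_def)

lemma radius_square: "(radius \<tau> r x)\<^sup>2 = r\<^sup>2 + fibre_weight \<tau> x * (cmod (theta \<tau> x))\<^sup>2"
  by (simp add: radius_def)

lemma radius_ge_abs: "\<bar>r\<bar> \<le> radius \<tau> r x"
  unfolding radius_def by (rule real_le_rsqrt) simp

lemma radius_gt_abs:
  assumes "theta \<tau> x \<noteq> 0"
  shows "\<bar>r\<bar> < radius \<tau> r x"
  unfolding radius_def using assms by (intro real_less_rsqrt) simp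

lemma radius_product:
  "(radius \<tau> r x + r) * (radius \<tau> r x - r) = fibre_weight \<tau> x * (cmod (theta \<tau> x))\<^sup>2"
  using radius_square[of \<tau> r x] by (simp add: algebra_simps power2_eq_square)

text \<open>The two weighted squared norms have difference \<open>2 * r\<close>, and their product
  is the weighted squared norm of theta; this determines their sum, and so each of them.\<close>

lemma norms_eq_radius_moment:
  assumes "z * w = theta \<tau> x"
  shows "(cmod z)\<^sup>2 = radius \<tau> (moment \<tau> z w x) x + moment \<tau> z w x"
    and "fibre_weight \<tau> x * (cmod w)\<^sup>2 = radius \<tau> (moment \<tau> z w x) x - moment \<tau> z w x"
proof -
  have "(moment \<tau> z w x)\<^sup>2 + fibre_weight \<tau> x * (cmod (theta \<tau> x))\<^sup>2 =
      ((1/2) * ((cmod z)\<^sup>2 + fibre_weight \<tau> x * (cmod w)\<^sup>2))\<^sup>2"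
    unfolding assms[symmetric] moment_def norm_mult by (simp add: power2_eq_square field_simps)
  then have "radius \<tau> (moment \<tau> z w x) x = (1/2) * ((cmod z)\<^sup>2 + fibre_weight \<tau> x * (cmod w)\<^sup>2)"
    unfolding radius_def by simp
  then show "(cmod z)\<^sup>2 = radius \<tau> (moment \<tau> z w x) x + moment \<tau> z w x"
    and "fibre_weight \<tau> x * (cmod w)\<^sup>2 = radius \<tau> (moment \<tau> z w x) x - moment \<tau> z w x"
    by (auto simp: moment_def field_simps)
qed

text \<open>Every point of the base is attained on the level set, so regularity, a condition on
  points above, yields a condition at every \<open>(r, x)\<close>.\<close>

lemma fibre_nonempty:
  obtains z w where "z * w = theta \<tau> x" "moment \<tau> z w x = r"
proof (cases "radius \<tau> r x + r = 0")
  case False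
  define N where "N = radius \<tau> r x + r"
  have N: "N > 0" using False radius_ge_abs[of r \<tau> x] by (simp add: N_def)
  have "fibre_weight \<tau> x * (cmod (theta \<tau> x))\<^sup>2 = N * (N - 2 * r)"
    using radius_product[of \<tau> r x] by (simp add: N_def algebra_simps)
  then have "moment \<tau> (of_real (sqrt N)) (theta \<tau> x / of_real (sqrt N)) x = r"
    using N by (simp add: moment_def norm_divide power_divide)
  then show ?thesis using that[of "of_real (sqrt N)" "theta \<tau> x / of_real (sqrt N)"] N by simp
next
  case True
  then have th: "theta \<tau> x = 0" using radius_gt_abs[of \<tau> x r] by force
  have r: "r \<le> 0" using True radius_ge_abs[of r \<tau> x] by simp
  have "moment \<tau> 0 (of_real (sqrt (- 2 * r / fibre_weight \<tau> x))) x = r"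
    using r by (simp add: moment_def divide_nonpos_pos)
  then show ?thesis using that[of 0] th by auto
qed

lemma continuous_on_fibre_weight [continuous_intros]:
  "continuous_on A f \<Longrightarrow> continuous_on A (\<lambda>p. fibre_weight \<tau> (f p))"
  unfolding fibre_weight_def divide_inverse by (intro continuous_intros)

lemma continuous_on_moment [continuous_intros]:
  assumes "continuous_on A f" "continuous_on A g" "continuous_on A h"
  shows "continuous_on A (\<lambda>p. moment \<tau> (f p) (g p) (h p))"
  unfolding moment_def by (intro continuous_intros assms)

lemma continuous_on_radius [continuous_intros]:
  assumes "Im \<tau> > 0" "continuous_on A f" "continuous_on A g"
  shows "continuous_on A (\<lambda>p. radius \<tau> (f p) (g p))"
  unfolding radius_def by (intro continuous_intros continuous_on_theta assms)

text \<open>Moving the real moment over a fixed \<open>x\<close> amounts to \<open>(z, w) \<mapsto> (s z, w / s)\<close>. The two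
  expressions \<open>(R' + r') / (R + r)\<close> and \<open>(R - r) / (R' - r')\<close> for \<open>s\<^sup>2\<close> may degenerate; their
  mediant does so only at \<open>z = w = 0\<close>.\<close>
definition rescale :: "complex \<Rightarrow> real \<Rightarrow> real \<Rightarrow> complex \<Rightarrow> real" where
  "rescale \<tau> r r' x = sqrt ((radius \<tau> r x + radius \<tau> r' x + r' - r) / (radius \<tau> r x + radius \<tau> r' x + r - r'))"

text \<open>At a zero of theta the radius is the absolute value, and the two sums are
  \<open>2 * \<bar>r\<bar>\<close> and \<open>2 * \<bar>r'\<bar>\<close> in some order because r and
  r' have the same nonzero sign. Elsewhere both radii exceed the absolute values strictly.\<close>

lemma rescale_pos:
  assumes "theta \<tau> x = 0 \<Longrightarrow> sgn r' = sgn r" "theta \<tau> x \<noteq> 0 \<or> r \<noteq> 0"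
  shows "radius \<tau> r x + radius \<tau> r' x + r - r' > 0" "radius \<tau> r x + radius \<tau> r' x + r' - r > 0"
proof -
  have "radius \<tau> r x + radius \<tau> r' x + r - r' > 0 \<and> radius \<tau> r x + radius \<tau> r' x + r' - r > 0"
  proof (cases "theta \<tau> x = 0")
    case True
    then have "r \<noteq> 0" "sgn r' = sgn r" using assms by auto
    then show ?thesis using radius_ge_abs[of r \<tau> x] radius_ge_abs[of r' \<tau> x]
      by (auto simp: sgn_if split: if_splits)
  next
    case False
    then show ?thesis using radius_gt_abs[OF False, of r] radius_gt_abs[OF False, of r'] by linarith
  qed
  then show "radius \<tau> r x + radius \<tau> r' x + r - r' > 0" "radius \<tau> r x + radius \<tau> r' x + r' - r > 0" by auto
qed

lemma rescale_properties:
  assumes zw: "z * w = theta \<tau> x" and r: "r = moment \<tau> z w x"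
    and sgn: "theta \<tau> x = 0 \<Longrightarrow> sgn r' = sgn r"
  shows "(of_real (rescale \<tau> r r' x) * z) * (w / of_real (rescale \<tau> r r' x)) = theta \<tau> x"
    and "moment \<tau> (of_real (rescale \<tau> r r' x) * z) (w / of_real (rescale \<tau> r r' x)) x = r'"
    and "of_real (rescale \<tau> r' r x) * (of_real (rescale \<tau> r r' x) * z) = z"
    and "w / of_real (rescale \<tau> r r' x) / of_real (rescale \<tau> r' r x) = w"
proof -
  have "(of_real (rescale \<tau> r r' x) * z) * (w / of_real (rescale \<tau> r r' x)) = theta \<tau> x \<and>
    moment \<tau> (of_real (rescale \<tau> r r' x) * z) (w / of_real (rescale \<tau> r r' x)) x = r' \<and>
    of_real (rescale \<tau> r' r x) * (of_real (rescale \<tau> r r' x) * z) = z \<and>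
    w / of_real (rescale \<tau> r r' x) / of_real (rescale \<tau> r' r x) = w"
  proof (cases "theta \<tau> x = 0 \<and> r = 0")
    case True
    \<comment> \<open>The scaling factor is now a quotient of zeros, that is 0, and \<open>w\<close>
      is divided by 0; both coordinates vanish, so these default values do no harm.\<close>
    then have "cmod z = 0" "cmod w = 0" "r' = 0"
      using norms_eq_radius_moment[OF zw] sgn r by (auto simp: radius_def sgn_zero_iff)
    then show ?thesis using True zw by (auto simp: moment_def)
  next
    case False
    define R R' where "R = radius \<tau> r x" and "R' = radius \<tau> r' x"
    define P Q where "P = R + R' + r' - r" and "Q = R + R' + r - r'"
    have pos: "P > 0" "Q > 0"
      using rescale_pos[OF sgn] False unfolding P_def Q_def R_def R'_def by auto
    have s: "rescale \<tau> r r' x = sqrt (P / Q)" by (simp add: rescale_def P_def Q_def R_def R'_def)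
    have s': "rescale \<tau> r' r x = sqrt (Q / P)"
      by (simp add: rescale_def P_def Q_def R_def R'_def add.commute)
    have RR: "(R + r) * (R - r) = (R' + r') * (R' - r')"
      unfolding R_def R'_def radius_product by simp
    \<comment> \<open>By \<open>RR\<close> the fractions \<open>(R' + r') / (R + r)\<close> and
      \<open>(R - r) / (R' - r')\<close> agree where defined; \<open>P / Q\<close> is their mediant,
      and the cross-multiplied identities survive a vanishing denominator.\<close>
    have "P * (R + r) = Q * (R' + r')" "Q * (R - r) = P * (R' - r')"
      using RR unfolding P_def Q_def by (simp_all add: algebra_simps)
    then have n: "P / Q * (R + r) = R' + r'" "Q / P * (R - r) = R' - r'"
      using pos by (simp_all add: field_simps)
    have "(cmod (of_real (sqrt (P / Q)) * z))\<^sup>2 = P / Q * (cmod z)\<^sup>2"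
      using pos by (simp add: norm_mult power_mult_distrib)
    also have "\<dots> = R' + r'" using norms_eq_radius_moment(1)[OF zw] n(1) by (simp add: r R_def)
    finally have 1: "(cmod (of_real (sqrt (P / Q)) * z))\<^sup>2 = R' + r'" .
    have "fibre_weight \<tau> x * (cmod (w / of_real (sqrt (P / Q))))\<^sup>2 = Q / P * (fibre_weight \<tau> x * (cmod w)\<^sup>2)"
      using pos by (simp add: norm_divide power_divide)
    also have "\<dots> = R' - r'" using norms_eq_radius_moment(2)[OF zw] n(2) by (simp add: r R_def)
    finally have 2: "fibre_weight \<tau> x * (cmod (w / of_real (sqrt (P / Q))))\<^sup>2 = R' - r'" .
    have m: "moment \<tau> (of_real (sqrt (P / Q)) * z) (w / of_real (sqrt (P / Q))) x = r'"
      unfolding moment_def 1 2 by simp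
    have inv: "sqrt (Q / P) * sqrt (P / Q) = 1"
      using pos by (simp add: real_sqrt_mult[symmetric])
    then have inv': "complex_of_real (sqrt (Q / P)) * of_real (sqrt (P / Q)) = 1"
      unfolding of_real_mult[symmetric] by simp
    have nz: "complex_of_real (sqrt (P / Q)) \<noteq> 0" "complex_of_real (sqrt (Q / P)) \<noteq> 0"
      using inv' by fastforce+
    have "w / of_real (sqrt (P / Q)) / of_real (sqrt (Q / P)) = w / (of_real (sqrt (Q / P)) * of_real (sqrt (P / Q)))"
      by (simp only: divide_divide_eq_left mult.commute)
    then have 3: "w / of_real (sqrt (P / Q)) / of_real (sqrt (Q / P)) = w" by (simp only: inv' div_by_1)
    have 4: "of_real (sqrt (Q / P)) * (of_real (sqrt (P / Q)) * z) = z"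
      by (simp only: mult.assoc[symmetric] inv' mult_1)
    show ?thesis unfolding s s' using m 3 4 nz(1) zw by (simp only: ) (simp add: field_simps)
  qed
  then show "(of_real (rescale \<tau> r r' x) * z) * (w / of_real (rescale \<tau> r r' x)) = theta \<tau> x"
    and "moment \<tau> (of_real (rescale \<tau> r r' x) * z) (w / of_real (rescale \<tau> r r' x)) x = r'"
    and "of_real (rescale \<tau> r' r x) * (of_real (rescale \<tau> r r' x) * z) = z"
    and "w / of_real (rescale \<tau> r r' x) / of_real (rescale \<tau> r' r x) = w" by auto
qed

lemma tendsto_zero_if_norm_power2:
  fixes f :: "'a \<Rightarrow> complex"
  assumes "(g \<longlongrightarrow> 0) F" "\<forall>\<^sub>F p in F. (cmod (f p))\<^sup>2 = g p"
  shows "(f \<longlongrightarrow> 0) F"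
proof -
  have "((\<lambda>p. sqrt (g p)) \<longlongrightarrow> sqrt 0) F" using assms(1) by (rule tendsto_real_sqrt)
  moreover have "\<forall>\<^sub>F p in F. norm (f p) \<le> sqrt (g p)"
    using assms(2) by eventually_elim (metis norm_ge_zero order_refl real_sqrt_unique)
  ultimately show ?thesis by (intro Lim_null_comparison[of f "\<lambda>p. sqrt (g p)"]) auto
qed

text \<open>Where \<open>z\<close> and \<open>w\<close> both vanish the factor itself need not
  converge. There the limit 0 is read off from the norms of the images, which are continuous
  expressions in r' and x.\<close>

lemma continuous_on_rescale:
  fixes z w x :: "'a::t2_space \<Rightarrow> complex" and r' :: "'a \<Rightarrow> real"
  assumes \<tau>: "Im \<tau> > 0" and cont: "continuous_on A z" "continuous_on A w" "continuous_on A x" "continuous_on A r'"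
    and zw: "\<And>p. p \<in> A \<Longrightarrow> z p * w p = theta \<tau> (x p)"
    and r: "\<And>p. p \<in> A \<Longrightarrow> r p = moment \<tau> (z p) (w p) (x p)"
    and sgn: "\<And>p. p \<in> A \<Longrightarrow> theta \<tau> (x p) = 0 \<Longrightarrow> sgn (r' p) = sgn (r p)"
  shows "continuous_on A (\<lambda>p. of_real (rescale \<tau> (r p) (r' p) (x p)) * z p)" (is "continuous_on A ?z")
    and "continuous_on A (\<lambda>p. w p / of_real (rescale \<tau> (r p) (r' p) (x p)))" (is "continuous_on A ?w")
proof -
  have cr: "continuous_on A r"
    using continuous_on_moment[OF cont(1-3)] by (rule continuous_on_eq) (simp add: r)
  have cR: "continuous_on A (\<lambda>p. radius \<tau> (r p) (x p))" "continuous_on A (\<lambda>p. radius \<tau> (r' p) (x p))"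
    by (intro continuous_on_radius \<tau> cr cont)+
  note cont = cont cr cR
  have lim: "(f \<longlongrightarrow> f p) (at p within A)" if "continuous_on A f" "p \<in> A" for f :: "'a \<Rightarrow> 'b::topological_space" and p
    using that by (simp add: continuous_on_def)
  have ev: "\<forall>\<^sub>F q in at p within A. q \<in> A" for p by (simp add: eventually_at_filter)
  have "(?z \<longlongrightarrow> ?z p) (at p within A) \<and> (?w \<longlongrightarrow> ?w p) (at p within A)" if p: "p \<in> A" for p
  proof (cases "theta \<tau> (x p) = 0 \<and> r p = 0")
    case False
    have pos: "radius \<tau> (r p) (x p) + radius \<tau> (r' p) (x p) + r p - r' p \<noteq> 0"
      "radius \<tau> (r p) (x p) + radius \<tau> (r' p) (x p) + r' p - r p \<noteq> 0"
      using rescale_pos[of \<tau> "x p" "r' p" "r p"] sgn[OF p] False by auto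
    then have nz: "complex_of_real (rescale \<tau> (r p) (r' p) (x p)) \<noteq> 0"
      unfolding of_real_eq_0_iff rescale_def by simp
    have "((\<lambda>p. rescale \<tau> (r p) (r' p) (x p)) \<longlongrightarrow> rescale \<tau> (r p) (r' p) (x p)) (at p within A)"
      unfolding rescale_def using pos by (intro tendsto_intros lim cont p) auto
    then show ?thesis
      by (intro conjI tendsto_mult tendsto_divide tendsto_of_real lim[OF cont(1) p] lim[OF cont(2) p] nz)
  next
    case True
    have r'0: "r' p = 0" using sgn[OF p] True by (simp add: sgn_zero_iff)
    have R0: "radius \<tau> (r p) (x p) = 0" "radius \<tau> (r' p) (x p) = 0" using True r'0 by (auto simp: radius_def)
    have "z p = 0" "w p = 0" using norms_eq_radius_moment[OF zw[OF p]] r[OF p, symmetric] True R0 by auto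
    have rd: "((\<lambda>q. radius \<tau> (r' q) (x q) + r' q) \<longlongrightarrow> 0 + 0) (at p within A)"
      "((\<lambda>q. (radius \<tau> (r' q) (x q) - r' q) / fibre_weight \<tau> (x q)) \<longlongrightarrow> (0 - 0) / fibre_weight \<tau> (x p)) (at p within A)"
      using lim[OF cont(4) p] lim[OF cont(7) p] lim[OF continuous_on_fibre_weight[OF cont(3)] p] r'0 R0
      by (intro tendsto_intros; simp)+
    have "(?z \<longlongrightarrow> 0) (at p within A)"
    proof (rule tendsto_zero_if_norm_power2)
      show "\<forall>\<^sub>F q in at p within A. (cmod (?z q))\<^sup>2 = radius \<tau> (r' q) (x q) + r' q"
        using ev
      proof eventually_elim
        case (elim q)
        have rp: "?z q * ?w q = theta \<tau> (x q)" "moment \<tau> (?z q) (?w q) (x q) = r' q"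
          using rescale_properties(1,2)[OF zw[OF elim] r[OF elim]] sgn[OF elim] by blast+
        show ?case using norms_eq_radius_moment(1)[OF rp(1)] unfolding rp(2) .
      qed
    qed (use rd in simp)
    moreover have "(?w \<longlongrightarrow> 0) (at p within A)"
    proof (rule tendsto_zero_if_norm_power2)
      show "\<forall>\<^sub>F q in at p within A. (cmod (?w q))\<^sup>2 = (radius \<tau> (r' q) (x q) - r' q) / fibre_weight \<tau> (x q)"
        using ev
      proof eventually_elim
        case (elim q)
        have rp: "?z q * ?w q = theta \<tau> (x q)" "moment \<tau> (?z q) (?w q) (x q) = r' q"
          using rescale_properties(1,2)[OF zw[OF elim] r[OF elim]] sgn[OF elim] by blast+
        show ?case using norms_eq_radius_moment(2)[OF rp(1)] unfolding rp(2) by (simp add: field_simps)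
      qed
    qed (use rd in simp)
    ultimately show ?thesis using \<open>z p = 0\<close> \<open>w p = 0\<close> by simp
  qed
  then show "continuous_on A ?z" "continuous_on A ?w" by (auto simp: continuous_on_def)
qed

text \<open>Moving \<open>x\<close> to \<open>x'\<close> at fixed real moment \<open>r\<close> keeps the phase of \<open>z\<close> if \<open>r > 0\<close> and that
  of \<open>w\<close> if \<open>r < 0\<close>.\<close>
definition scale_z :: "complex \<Rightarrow> real \<Rightarrow> complex \<Rightarrow> complex \<Rightarrow> real" where
  "scale_z \<tau> r x x' = sqrt ((radius \<tau> r x' + r) / (radius \<tau> r x + r))"

definition scale_w :: "complex \<Rightarrow> real \<Rightarrow> complex \<Rightarrow> complex \<Rightarrow> real" where
  "scale_w \<tau> r x x' =
     sqrt ((radius \<tau> r x' - r) * fibre_weight \<tau> x / ((radius \<tau> r x - r) * fibre_weight \<tau> x'))"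

text \<open>Dividing theta by the other, nonvanishing coordinate restores the equation at
  \<open>x'\<close>. The branch \<open>r = 0\<close> keeps the point, which is correct only together
  with \<open>x' = x\<close>.\<close>

definition transport_z :: "complex \<Rightarrow> real \<Rightarrow> complex \<Rightarrow> complex \<Rightarrow> complex \<Rightarrow> complex \<Rightarrow> complex" where
  "transport_z \<tau> r z w x x' =
     (if r > 0 then of_real (scale_z \<tau> r x x') * z
      else if r < 0 then theta \<tau> x' / (of_real (scale_w \<tau> r x x') * w) else z)"

definition transport_w :: "complex \<Rightarrow> real \<Rightarrow> complex \<Rightarrow> complex \<Rightarrow> complex \<Rightarrow> complex \<Rightarrow> complex" where
  "transport_w \<tau> r z w x x' =
     (if r > 0 then theta \<tau> x' / (of_real (scale_z \<tau> r x x') * z)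
      else if r < 0 then of_real (scale_w \<tau> r x x') * w else w)"

lemma radius_plus_pos: "r > 0 \<Longrightarrow> radius \<tau> r x + r > 0"
  using radius_ge_abs[of r \<tau> x] by linarith

lemma radius_minus_pos: "r < 0 \<Longrightarrow> radius \<tau> r x - r > 0"
  using radius_ge_abs[of r \<tau> x] by linarith

lemma scale_z_pos: "r > 0 \<Longrightarrow> scale_z \<tau> r x x' > 0"
  by (simp add: scale_z_def radius_plus_pos)

lemma scale_w_pos: "r < 0 \<Longrightarrow> scale_w \<tau> r x x' > 0"
  unfolding scale_w_def by (intro real_sqrt_gt_zero divide_pos_pos mult_pos_pos radius_minus_pos) auto

lemma scale_z_inverse: "r > 0 \<Longrightarrow> scale_z \<tau> r x' x * scale_z \<tau> r x x' = 1"
  unfolding scale_z_def real_sqrt_mult[symmetric]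
  using radius_plus_pos[of r \<tau> x] radius_plus_pos[of r \<tau> x'] by simp

lemma scale_w_inverse: "r < 0 \<Longrightarrow> scale_w \<tau> r x' x * scale_w \<tau> r x x' = 1"
  unfolding scale_w_def real_sqrt_mult[symmetric]
  using radius_minus_pos[of r \<tau> x] radius_minus_pos[of r \<tau> x'] by simp

text \<open>The scale makes one norm right; the other follows because the product of the weighted
  squared norms is prescribed by \<open>radius_product\<close>. Going back uses the reciprocal scale
  on the same coordinate, and the equation recovers the other one.\<close>

lemma transport_properties:
  assumes zw: "z * w = theta \<tau> x" and r: "r = moment \<tau> z w x" and x': "r = 0 \<Longrightarrow> x' = x"
  shows "transport_z \<tau> r z w x x' * transport_w \<tau> r z w x x' = theta \<tau> x'"
    and "moment \<tau> (transport_z \<tau> r z w x x') (transport_w \<tau> r z w x x') x' = r"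
    and "transport_z \<tau> r (transport_z \<tau> r z w x x') (transport_w \<tau> r z w x x') x' x = z"
    and "transport_w \<tau> r (transport_z \<tau> r z w x x') (transport_w \<tau> r z w x x') x' x = w"
proof -
  define z' w' where "z' = transport_z \<tau> r z w x x'" and "w' = transport_w \<tau> r z w x x'"
  have norms: "(cmod z)\<^sup>2 = radius \<tau> r x + r" "fibre_weight \<tau> x * (cmod w)\<^sup>2 = radius \<tau> r x - r"
    using norms_eq_radius_moment[OF zw] r by auto
  have "z' * w' = theta \<tau> x' \<and> moment \<tau> z' w' x' = r \<and>
      transport_z \<tau> r z' w' x' x = z \<and> transport_w \<tau> r z' w' x' x = w"
  proof (cases r "0::real" rule: linorder_cases)
    case equal
    then show ?thesis using x' zw r by (simp add: z'_def w'_def transport_z_def transport_w_def)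
  next
    case greater
    define s where "s = scale_z \<tau> r x x'"
    have s: "s > 0" using scale_z_pos[OF greater] by (simp add: s_def)
    have zw': "z' = of_real s * z" "w' = theta \<tau> x' / z'"
      using greater by (auto simp: z'_def w'_def transport_z_def transport_w_def s_def)
    have z: "z \<noteq> 0" using norms(1) radius_plus_pos[OF greater, of \<tau> x] by force
    then have z': "z' \<noteq> 0" using s zw' by simp
    have n1: "(cmod z')\<^sup>2 = radius \<tau> r x' + r"
      using radius_plus_pos[OF greater, of \<tau> x] radius_plus_pos[OF greater, of \<tau> x']
      by (simp add: zw' norm_mult power_mult_distrib norms s_def scale_z_def)
    have "fibre_weight \<tau> x' * (cmod w')\<^sup>2 =
        (radius \<tau> r x' + r) * (radius \<tau> r x' - r) / (cmod z')\<^sup>2"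
      unfolding radius_product zw'(2) by (simp add: norm_divide power_divide)
    then have n2: "fibre_weight \<tau> x' * (cmod w')\<^sup>2 = radius \<tau> r x' - r"
      using radius_plus_pos[OF greater, of \<tau> x'] by (simp add: n1)
    have inv: "complex_of_real (scale_z \<tau> r x' x) * of_real s = 1"
      unfolding of_real_mult[symmetric] s_def scale_z_inverse[OF greater] by simp
    have 3: "transport_z \<tau> r z' w' x' x = z"
      using greater inv by (simp add: transport_z_def zw' mult.assoc[symmetric])
    have "transport_w \<tau> r z' w' x' x = theta \<tau> x / transport_z \<tau> r z' w' x' x"
      using greater by (simp add: transport_w_def transport_z_def)
    then have 4: "transport_w \<tau> r z' w' x' x = w" unfolding 3 using z zw[symmetric] by simp
    have "moment \<tau> z' w' x' = r" unfolding moment_def n1 n2 by simp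
    moreover have "z' * w' = theta \<tau> x'" using zw'(2) z' by simp
    ultimately show ?thesis using 3 4 by blast
  next
    case less
    define s where "s = scale_w \<tau> r x x'"
    have s: "s > 0" using scale_w_pos[OF less] by (simp add: s_def)
    have zw': "w' = of_real s * w" "z' = theta \<tau> x' / w'"
      using less by (auto simp: z'_def w'_def transport_z_def transport_w_def s_def)
    have w: "w \<noteq> 0" using norms(2) radius_minus_pos[OF less, of \<tau> x] by force
    then have w': "w' \<noteq> 0" using s zw' by simp
    have cw: "(cmod w)\<^sup>2 = (radius \<tau> r x - r) / fibre_weight \<tau> x" using norms(2) by (simp add: field_simps)
    have s2: "s\<^sup>2 = (radius \<tau> r x' - r) * fibre_weight \<tau> x / ((radius \<tau> r x - r) * fibre_weight \<tau> x')"
      unfolding s_def scale_w_def using radius_minus_pos[OF less, of \<tau> x] radius_minus_pos[OF less, of \<tau> x']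
      by (intro real_sqrt_pow2) (simp add: less_imp_le)
    have n2: "fibre_weight \<tau> x' * (cmod w')\<^sup>2 = radius \<tau> r x' - r"
      using radius_minus_pos[OF less, of \<tau> x] radius_minus_pos[OF less, of \<tau> x']
      by (simp add: zw' norm_mult power_mult_distrib cw s2 field_simps)
    have "(cmod z')\<^sup>2 * (fibre_weight \<tau> x' * (cmod w')\<^sup>2) =
        (radius \<tau> r x' + r) * (radius \<tau> r x' - r)"
      unfolding radius_product zw'(2) using w' by (simp add: norm_divide power_divide)
    then have n1: "(cmod z')\<^sup>2 = radius \<tau> r x' + r"
      using radius_minus_pos[OF less, of \<tau> x'] by (simp add: n2)
    have inv: "complex_of_real (scale_w \<tau> r x' x) * of_real s = 1"
      unfolding of_real_mult[symmetric] s_def scale_w_inverse[OF less] by simp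
    have 4: "transport_w \<tau> r z' w' x' x = w"
      using less inv by (simp add: transport_w_def zw' mult.assoc[symmetric])
    have "transport_z \<tau> r z' w' x' x = theta \<tau> x / transport_w \<tau> r z' w' x' x"
      using less by (simp add: transport_w_def transport_z_def)
    then have 3: "transport_z \<tau> r z' w' x' x = z" unfolding 4 using w zw[symmetric] by simp
    have "moment \<tau> z' w' x' = r" unfolding moment_def n1 n2 by simp
    moreover have "z' * w' = theta \<tau> x'" using zw'(2) w' by simp
    ultimately show ?thesis using 3 4 by blast
  qed
  then show "transport_z \<tau> r z w x x' * transport_w \<tau> r z w x x' = theta \<tau> x'"
    and "moment \<tau> (transport_z \<tau> r z w x x') (transport_w \<tau> r z w x x') x' = r"
    and "transport_z \<tau> r (transport_z \<tau> r z w x x') (transport_w \<tau> r z w x x') x' x = z"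
    and "transport_w \<tau> r (transport_z \<tau> r z w x x') (transport_w \<tau> r z w x x') x' x = w"
    unfolding z'_def w'_def by auto
qed

lemma transport_same:
  assumes zw: "z * w = theta \<tau> x" and r: "r = moment \<tau> z w x"
  shows "transport_z \<tau> r z w x x = z" "transport_w \<tau> r z w x x = w"
proof -
  have norms: "(cmod z)\<^sup>2 = radius \<tau> r x + r" "fibre_weight \<tau> x * (cmod w)\<^sup>2 = radius \<tau> r x - r"
    using norms_eq_radius_moment[OF zw] r by auto
  have z: "z \<noteq> 0" if "r > 0" using norms(1) radius_plus_pos[OF that, of \<tau> x] by force
  have w: "w \<noteq> 0" if "r < 0" using norms(2) radius_minus_pos[OF that, of \<tau> x] by force
  have sz: "scale_z \<tau> r x x = 1" if "r > 0" using radius_plus_pos[OF that, of \<tau> x] by (simp add: scale_z_def)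
  have sw: "scale_w \<tau> r x x = 1" if "r < 0" using radius_minus_pos[OF that, of \<tau> x] by (simp add: scale_w_def)
  show "transport_z \<tau> r z w x x = z" "transport_w \<tau> r z w x x = w"
    using z w sz sw by (auto simp: transport_z_def transport_w_def zw[symmetric])
qed

text \<open>The construction switches from \<open>z\<close> to \<open>w\<close> as r changes sign.
  The threshold \<open>e\<close> hides the switch: near r = 0 one has x' = x, and there all branches
  are the identity by \<open>transport_same\<close>.\<close>

lemma continuous_on_transport:
  fixes z w x x' :: "'a::t2_space \<Rightarrow> complex"
  assumes \<tau>: "Im \<tau> > 0" and cont: "continuous_on A z" "continuous_on A w" "continuous_on A x" "continuous_on A x'"
    and zw: "\<And>p. p \<in> A \<Longrightarrow> z p * w p = theta \<tau> (x p)"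
    and r: "\<And>p. p \<in> A \<Longrightarrow> r p = moment \<tau> (z p) (w p) (x p)"
    and e: "e > 0" "\<And>p. p \<in> A \<Longrightarrow> \<bar>r p\<bar> < e \<Longrightarrow> x' p = x p"
  shows "continuous_on A (\<lambda>p. transport_z \<tau> (r p) (z p) (w p) (x p) (x' p))" (is "continuous_on A ?z")
    and "continuous_on A (\<lambda>p. transport_w \<tau> (r p) (z p) (w p) (x p) (x' p))" (is "continuous_on A ?w")
proof -
  have cr: "continuous_on A r"
    using continuous_on_moment[OF cont(1-3)] by (rule continuous_on_eq) (simp add: r)
  have cR: "continuous_on A (\<lambda>p. radius \<tau> (r p) (x p))" "continuous_on A (\<lambda>p. radius \<tau> (r p) (x' p))"
    by (intro continuous_on_radius \<tau> cr cont)+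
  have cth: "continuous_on A (\<lambda>p. theta \<tau> (x' p))" by (intro continuous_on_theta \<tau> cont)
  have cf: "continuous_on A (\<lambda>p. fibre_weight \<tau> (x p))" "continuous_on A (\<lambda>p. fibre_weight \<tau> (x' p))"
    by (intro continuous_on_fibre_weight cont)+
  have lim: "(f \<longlongrightarrow> f p) (at p within A)" if "continuous_on A f" "p \<in> A" for f :: "'a \<Rightarrow> 'b::topological_space" and p
    using that by (simp add: continuous_on_def)
  have ev: "\<forall>\<^sub>F q in at p within A. q \<in> A" for p by (simp add: eventually_at_filter)
  have "(?z \<longlongrightarrow> ?z p) (at p within A) \<and> (?w \<longlongrightarrow> ?w p) (at p within A)" if p: "p \<in> A" for p
  proof (cases "r p" "0::real" rule: linorder_cases)
    case equal
    have "\<forall>\<^sub>F q in at p within A. \<bar>r q\<bar> < e"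
      using order_tendstoD(2)[OF tendsto_rabs[OF lim[OF cr p]], of e] equal e(1) by simp
    with ev have same: "\<forall>\<^sub>F q in at p within A. z q = ?z q \<and> w q = ?w q"
      by eventually_elim (metis e(2) transport_same zw r)
    have "?z p = z p" "?w p = w p" using equal by (auto simp: transport_z_def transport_w_def)
    moreover have "(?z \<longlongrightarrow> z p) (at p within A)" "(?w \<longlongrightarrow> w p) (at p within A)"
      by (rule Lim_transform_eventually[OF lim[OF cont(1) p]], use same in \<open>eventually_elim, simp\<close>)
        (rule Lim_transform_eventually[OF lim[OF cont(2) p]], use same in \<open>eventually_elim, simp\<close>)
    ultimately show ?thesis by simp
  next
    case greater
    have "z p \<noteq> 0"
      using norms_eq_radius_moment(1)[OF zw[OF p]] r[OF p] radius_plus_pos[OF greater, of \<tau> "x p"] by force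
    then have nz: "of_real (scale_z \<tau> (r p) (x p) (x' p)) * z p \<noteq> 0"
      using scale_z_pos[OF greater, of \<tau> "x p" "x' p"] by simp
    have sc: "((\<lambda>q. scale_z \<tau> (r q) (x q) (x' q)) \<longlongrightarrow> scale_z \<tau> (r p) (x p) (x' p)) (at p within A)"
      unfolding scale_z_def using radius_plus_pos[OF greater, of \<tau> "x p"]
      by (intro tendsto_real_sqrt tendsto_divide tendsto_add lim[OF cR(1) p] lim[OF cR(2) p] lim[OF cr p]) auto
    have pos: "\<forall>\<^sub>F q in at p within A. r q > 0" using order_tendstoD(1)[OF lim[OF cr p] greater] .
    have 1: "((\<lambda>q. of_real (scale_z \<tau> (r q) (x q) (x' q)) * z q) \<longlongrightarrow> ?z p) (at p within A)"
      using greater tendsto_mult[OF tendsto_of_real[OF sc] lim[OF cont(1) p]] by (simp add: transport_z_def)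
    have 2: "((\<lambda>q. theta \<tau> (x' q) / (of_real (scale_z \<tau> (r q) (x q) (x' q)) * z q)) \<longlongrightarrow> ?w p) (at p within A)"
      using greater tendsto_divide[OF lim[OF cth p] tendsto_mult[OF tendsto_of_real[OF sc] lim[OF cont(1) p]] nz]
      by (simp add: transport_w_def)
    show ?thesis
      by (intro conjI Lim_transform_eventually[OF 1] Lim_transform_eventually[OF 2];
          use pos in eventually_elim) (simp_all add: transport_z_def transport_w_def)
  next
    case less
    have "w p \<noteq> 0"
      using norms_eq_radius_moment(2)[OF zw[OF p]] r[OF p] radius_minus_pos[OF less, of \<tau> "x p"] by force
    then have nz: "of_real (scale_w \<tau> (r p) (x p) (x' p)) * w p \<noteq> 0"
      using scale_w_pos[OF less, of \<tau> "x p" "x' p"] by simp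
    have sc: "((\<lambda>q. scale_w \<tau> (r q) (x q) (x' q)) \<longlongrightarrow> scale_w \<tau> (r p) (x p) (x' p)) (at p within A)"
      unfolding scale_w_def using radius_minus_pos[OF less, of \<tau> "x p"]
      by (intro tendsto_real_sqrt tendsto_divide tendsto_mult tendsto_diff
          lim[OF cR(1) p] lim[OF cR(2) p] lim[OF cr p] lim[OF cf(1) p] lim[OF cf(2) p]) auto
    have neg: "\<forall>\<^sub>F q in at p within A. r q < 0" using order_tendstoD(2)[OF lim[OF cr p] less] .
    have 1: "((\<lambda>q. of_real (scale_w \<tau> (r q) (x q) (x' q)) * w q) \<longlongrightarrow> ?w p) (at p within A)"
      using less tendsto_mult[OF tendsto_of_real[OF sc] lim[OF cont(2) p]] by (simp add: transport_w_def)
    have 2: "((\<lambda>q. theta \<tau> (x' q) / (of_real (scale_w \<tau> (r q) (x q) (x' q)) * w q)) \<longlongrightarrow> ?z p) (at p within A)"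
      using less tendsto_divide[OF lim[OF cth p] tendsto_mult[OF tendsto_of_real[OF sc] lim[OF cont(2) p]] nz]
      by (simp add: transport_z_def)
    show ?thesis
      by (intro conjI Lim_transform_eventually[OF 1] Lim_transform_eventually[OF 2];
          use neg in eventually_elim) (simp_all add: transport_z_def transport_w_def)
  qed
  then show "continuous_on A ?z" "continuous_on A ?w" by (auto simp: continuous_on_def)
qed

section \<open>From single coordinates to level sets\<close>

lemma muR_nth: "muR \<tau> (z, w, x) $ i = moment \<tau> (z $ i) (w $ i) (x $ i)"
  by (simp add: muR_def moment_def fibre_weight_def)

lemma level_iff: "(z, w, x) \<in> level \<tau> u a b \<longleftrightarrow> (\<forall>i. z $ i * w $ i = theta \<tau> (x $ i)) \<and>
    iotaR_eq u (muR \<tau> (z, w, x)) a \<and> iotaC_eq u x b"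
  by (simp add: level_def Xn_def muC_def)

lemma muR_act: "(\<And>i. cmod (t $ i) = 1) \<Longrightarrow> muR \<tau> (act t p) = muR \<tau> p"
  by (cases p) (simp add: act_def muR_def vec_eq_iff norm_mult norm_inverse)

lemma continuous_on_muR: "continuous_on A (muR \<tau>)"
  unfolding muR_def case_prod_unfold divide_inverse
  by (intro continuous_on_vec_lambda continuous_intros)

definition base :: "('n::finite \<Rightarrow> int^'d::finite) \<Rightarrow> real^'n \<Rightarrow> complex^'n \<Rightarrow> ((real^'n) \<times> (complex^'n)) set" where
  "base u a b = {(r, x). iotaR_eq u r a \<and> iotaC_eq u x b}"

definition lift_real :: "complex \<Rightarrow> ((real^'n) \<times> (complex^'n) \<Rightarrow> real^'n) \<Rightarrow> 'n::finite pt \<Rightarrow> 'n pt" where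
  "lift_real \<tau> \<phi> p = (case p of (z, w, x) \<Rightarrow> let r = muR \<tau> p; r' = \<phi> (r, x) in
     (\<chi> i. of_real (rescale \<tau> (r $ i) (r' $ i) (x $ i)) * z $ i,
      \<chi> i. w $ i / of_real (rescale \<tau> (r $ i) (r' $ i) (x $ i)), x))"

lemma muR_lift_real:
  assumes "(z, w, x) \<in> level \<tau> u a b"
    and "\<And>i. theta \<tau> (x $ i) = 0 \<Longrightarrow> sgn (\<phi> (muR \<tau> (z, w, x), x) $ i) = sgn (muR \<tau> (z, w, x) $ i)"
  shows "muR \<tau> (lift_real \<tau> \<phi> (z, w, x)) = \<phi> (muR \<tau> (z, w, x), x)"
  using rescale_properties(2)[OF _ _ assms(2)] assms(1)
  by (simp add: lift_real_def Let_def vec_eq_iff muR_nth level_iff)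

lemma continuous_on_lift_real:
  assumes \<tau>: "Im \<tau> > 0" and \<phi>: "continuous_on (base u a b) \<phi>"
    and sgn: "\<And>r x i. (r, x) \<in> base u a b \<Longrightarrow> theta \<tau> (x $ i) = 0 \<Longrightarrow> sgn (\<phi> (r, x) $ i) = sgn (r $ i)"
  shows "continuous_on (level \<tau> u a b) (lift_real \<tau> \<phi>)"
proof -
  let ?L = "level \<tau> u a b"
  have c: "continuous_on ?L (\<lambda>p. fst p $ i)" "continuous_on ?L (\<lambda>p. fst (snd p) $ i)"
    "continuous_on ?L (\<lambda>p. snd (snd p) $ i)" for i
    by (intro continuous_intros)+
  have b: "(muR \<tau> p, snd (snd p)) \<in> base u a b" if "p \<in> ?L" for p
    using that by (cases p) (auto simp: base_def level_iff)
  have "continuous_on ?L (\<lambda>p. \<phi> (muR \<tau> p, snd (snd p)))"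
    by (rule continuous_on_compose2[OF \<phi>]) (auto intro!: continuous_intros continuous_on_muR b)
  then have c4: "continuous_on ?L (\<lambda>p. \<phi> (muR \<tau> p, snd (snd p)) $ i)" for i
    by (intro continuous_intros)
  have zw: "fst p $ i * fst (snd p) $ i = theta \<tau> (snd (snd p) $ i)" if "p \<in> ?L" for p i
    using that by (cases p) (auto simp: level_iff)
  have r: "muR \<tau> p $ i = moment \<tau> (fst p $ i) (fst (snd p) $ i) (snd (snd p) $ i)" for p i
    by (cases p) (simp add: muR_nth)
  have s: "sgn (\<phi> (muR \<tau> p, snd (snd p)) $ i) = sgn (muR \<tau> p $ i)"
    if "p \<in> ?L" "theta \<tau> (snd (snd p) $ i) = 0" for p i using sgn[OF b] that by blast
  have "lift_real \<tau> \<phi> = (\<lambda>p. (\<chi> i. of_real (rescale \<tau> (muR \<tau> p $ i) (\<phi> (muR \<tau> p, snd (snd p)) $ i) (snd (snd p) $ i)) * fst p $ i,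
      \<chi> i. fst (snd p) $ i / of_real (rescale \<tau> (muR \<tau> p $ i) (\<phi> (muR \<tau> p, snd (snd p)) $ i) (snd (snd p) $ i)), snd (snd p)))"
    by (auto simp: lift_real_def fun_eq_iff Let_def)
  moreover have "continuous_on ?L (\<lambda>p. of_real (rescale \<tau> (muR \<tau> p $ i) (\<phi> (muR \<tau> p, snd (snd p)) $ i) (snd (snd p) $ i)) * fst p $ i)"
    "continuous_on ?L (\<lambda>p. fst (snd p) $ i / of_real (rescale \<tau> (muR \<tau> p $ i) (\<phi> (muR \<tau> p, snd (snd p)) $ i) (snd (snd p) $ i)))" for i
    using continuous_on_rescale[OF \<tau> c c4, of i i i "\<lambda>p. muR \<tau> p $ i" i] zw r s by blast+
  moreover have "continuous_on ?L (\<lambda>p. snd (snd p))"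
    by (intro continuous_intros)
  ultimately show ?thesis
    by (simp only: continuous_on_Pair continuous_on_vec_lambda)
qed

lemma lift_real_level:
  assumes p: "p \<in> level \<tau> u a b"
    and \<phi>: "\<And>r x. (r, x) \<in> base u a b \<Longrightarrow> (\<phi> (r, x), x) \<in> base u a' b \<and> \<psi> (\<phi> (r, x), x) = r"
    and sgn: "\<And>r x i. (r, x) \<in> base u a b \<Longrightarrow> theta \<tau> (x $ i) = 0 \<Longrightarrow> sgn (\<phi> (r, x) $ i) = sgn (r $ i)"
  shows "lift_real \<tau> \<phi> p \<in> level \<tau> u a' b \<and> lift_real \<tau> \<psi> (lift_real \<tau> \<phi> p) = p"
proof -
  obtain z w x where pe: "p = (z, w, x)" by (cases p)
  define r where "r = muR \<tau> p"
  have b: "(r, x) \<in> base u a b" using p by (simp add: base_def level_iff pe r_def)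
  have zw: "z $ i * w $ i = theta \<tau> (x $ i)" for i using p by (simp add: pe level_iff)
  have r: "r $ i = moment \<tau> (z $ i) (w $ i) (x $ i)" for i by (simp add: r_def pe muR_nth)
  note rp = rescale_properties[OF zw r sgn[OF b]]
  have mu: "muR \<tau> (lift_real \<tau> \<phi> p) = \<phi> (r, x)"
    using muR_lift_real[of z w x \<tau> u a b \<phi>] p sgn b by (simp add: pe r_def)
  have lf: "lift_real \<tau> \<phi> p = (\<chi> i. of_real (rescale \<tau> (r $ i) (\<phi> (r, x) $ i) (x $ i)) * z $ i,
      \<chi> i. w $ i / of_real (rescale \<tau> (r $ i) (\<phi> (r, x) $ i) (x $ i)), x)"
    by (simp add: lift_real_def pe r_def Let_def)
  have "lift_real \<tau> \<phi> p \<in> level \<tau> u a' b"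
    using \<phi>[OF b] rp(1) unfolding lf level_iff by (simp add: mu[unfolded lf] base_def)
  moreover have "lift_real \<tau> \<psi> (lift_real \<tau> \<phi> p) = p"
    unfolding lift_real_def[of \<tau> \<psi>] mu unfolding lf using \<phi>[OF b] rp(3,4)
    by (simp add: Let_def pe vec_eq_iff)
  ultimately show ?thesis by simp
qed

lemma lift_real_act:
  assumes t: "\<And>i. cmod (t $ i) = 1"
  shows "lift_real \<tau> \<phi> (act t p) = act t (lift_real \<tau> \<phi> p)"
proof -
  obtain z w x where pe: "p = (z, w, x)" by (cases p)
  have mu: "muR \<tau> ((\<chi> i. t $ i * z $ i), (\<chi> i. inverse (t $ i) * w $ i), x) = muR \<tau> (z, w, x)"
    using muR_act[OF t, of \<tau> p] by (simp add: pe act_def)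
  show ?thesis
    by (simp add: pe act_def lift_real_def Let_def mu) (simp add: vec_eq_iff divide_inverse mult_ac)
qed

text \<open>Over a zero of theta the sign of the real moment tells which of the two coordinates
  vanishes, and at moment 0 both do. Rescaling cannot change this pattern, whence the sign condition
  exactly there. For \<psi> it follows by evaluating it at \<open>\<psi> (r, x)\<close>.\<close>

lemma Mtilde_homeomorphic_if_real_move:
  assumes \<tau>: "Im \<tau> > 0" and cont: "continuous_on (base u a b) \<phi>" "continuous_on (base u a' b) \<psi>"
    and \<phi>: "\<And>r x. (r, x) \<in> base u a b \<Longrightarrow> (\<phi> (r, x), x) \<in> base u a' b \<and> \<psi> (\<phi> (r, x), x) = r"
    and \<psi>: "\<And>r x. (r, x) \<in> base u a' b \<Longrightarrow> (\<psi> (r, x), x) \<in> base u a b \<and> \<phi> (\<psi> (r, x), x) = r"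
    and sgn: "\<And>r x i. (r, x) \<in> base u a b \<Longrightarrow> theta \<tau> (x $ i) = 0 \<Longrightarrow> sgn (\<phi> (r, x) $ i) = sgn (r $ i)"
  shows "Mtilde \<tau> u a b homeomorphic_space Mtilde \<tau> u a' b"
proof -
  have sgn': "sgn (\<psi> (r, x) $ i) = sgn (r $ i)" if "(r, x) \<in> base u a' b" "theta \<tau> (x $ i) = 0" for r x i
    using sgn[of "\<psi> (r, x)" x i] \<psi>[OF that(1)] that(2) by simp
  show ?thesis
  proof (rule Mtilde_homeomorphic_if_equivariant_homeomorphism[where f = "lift_real \<tau> \<phi>" and g = "lift_real \<tau> \<psi>"])
    show "continuous_on (level \<tau> u a b) (lift_real \<tau> \<phi>)"
      by (rule continuous_on_lift_real[OF \<tau> cont(1) sgn])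
    show "continuous_on (level \<tau> u a' b) (lift_real \<tau> \<psi>)"
      by (rule continuous_on_lift_real[OF \<tau> cont(2) sgn'])
    show "lift_real \<tau> \<phi> p \<in> level \<tau> u a' b \<and> lift_real \<tau> \<psi> (lift_real \<tau> \<phi> p) = p"
      if "p \<in> level \<tau> u a b" for p
      by (rule lift_real_level[OF that \<phi> sgn])
    show "lift_real \<tau> \<psi> p \<in> level \<tau> u a b \<and> lift_real \<tau> \<phi> (lift_real \<tau> \<psi> p) = p"
      if "p \<in> level \<tau> u a' b" for p
      by (rule lift_real_level[OF that \<psi> sgn'])
    show "lift_real \<tau> \<phi> (act t p) = act t (lift_real \<tau> \<phi> p)" if "\<And>i. cmod (t $ i) = 1" for p t
      by (rule lift_real_act[OF that])
  qed
qed

definition lift_complex :: "complex \<Rightarrow> (real^'n \<Rightarrow> complex^'n) \<Rightarrow> 'n::finite pt \<Rightarrow> 'n pt" where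
  "lift_complex \<tau> v p = (case p of (z, w, x) \<Rightarrow> let r = muR \<tau> p; x' = x + v r in
     (\<chi> i. transport_z \<tau> (r $ i) (z $ i) (w $ i) (x $ i) (x' $ i),
      \<chi> i. transport_w \<tau> (r $ i) (z $ i) (w $ i) (x $ i) (x' $ i), x'))"

lemma continuous_on_lift_complex:
  assumes \<tau>: "Im \<tau> > 0" and v: "continuous_on UNIV v"
    and e: "e > 0" "\<And>r i. \<bar>r $ i\<bar> < e \<Longrightarrow> v r $ i = 0"
  shows "continuous_on (level \<tau> u a b) (lift_complex \<tau> v)"
proof -
  let ?L = "level \<tau> u a b"
  have c: "continuous_on ?L (\<lambda>p. fst p $ i)" "continuous_on ?L (\<lambda>p. fst (snd p) $ i)"
    "continuous_on ?L (\<lambda>p. snd (snd p) $ i)" for i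
    by (intro continuous_intros)+
  have cv: "continuous_on ?L (\<lambda>p. v (muR \<tau> p))"
    by (rule continuous_on_compose2[OF v continuous_on_muR]) auto
  then have c4: "continuous_on ?L (\<lambda>p. (snd (snd p) + v (muR \<tau> p)) $ i)" for i
    by (intro continuous_intros)
  have zw: "fst p $ i * fst (snd p) $ i = theta \<tau> (snd (snd p) $ i)" if "p \<in> ?L" for p i
    using that by (cases p) (auto simp: level_iff)
  have r: "muR \<tau> p $ i = moment \<tau> (fst p $ i) (fst (snd p) $ i) (snd (snd p) $ i)" for p i
    by (cases p) (simp add: muR_nth)
  have s: "(snd (snd p) + v (muR \<tau> p)) $ i = snd (snd p) $ i" if "\<bar>muR \<tau> p $ i\<bar> < e" for p i
    using e(2)[OF that] by simp
  have "lift_complex \<tau> v = (\<lambda>p. (\<chi> i. transport_z \<tau> (muR \<tau> p $ i) (fst p $ i) (fst (snd p) $ i) (snd (snd p) $ i) ((snd (snd p) + v (muR \<tau> p)) $ i),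
      \<chi> i. transport_w \<tau> (muR \<tau> p $ i) (fst p $ i) (fst (snd p) $ i) (snd (snd p) $ i) ((snd (snd p) + v (muR \<tau> p)) $ i), snd (snd p) + v (muR \<tau> p)))"
    by (auto simp: lift_complex_def fun_eq_iff Let_def)
  moreover have "continuous_on ?L (\<lambda>p. transport_z \<tau> (muR \<tau> p $ i) (fst p $ i) (fst (snd p) $ i) (snd (snd p) $ i) ((snd (snd p) + v (muR \<tau> p)) $ i))"
    "continuous_on ?L (\<lambda>p. transport_w \<tau> (muR \<tau> p $ i) (fst p $ i) (fst (snd p) $ i) (snd (snd p) $ i) ((snd (snd p) + v (muR \<tau> p)) $ i))" for i
    using continuous_on_transport[OF \<tau> c c4 _ _ e(1), of i i i "\<lambda>p. muR \<tau> p $ i" i] zw r s by blast+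
  moreover have "continuous_on ?L (\<lambda>p. snd (snd p) + v (muR \<tau> p))"
    by (intro continuous_intros cv)
  ultimately show ?thesis
    by (simp only: continuous_on_Pair continuous_on_vec_lambda)
qed

lemma lift_complex_level:
  assumes p: "p \<in> level \<tau> u a b"
    and v: "\<And>r x. (r, x) \<in> base u a b \<Longrightarrow> iotaC_eq u (x + v r) b'"
    and vz: "\<And>r i. r $ i = 0 \<Longrightarrow> v r $ i = 0"
  shows "lift_complex \<tau> v p \<in> level \<tau> u a b' \<and> lift_complex \<tau> (\<lambda>r. - v r) (lift_complex \<tau> v p) = p"
proof -
  obtain z w x where pe: "p = (z, w, x)" by (cases p)
  define r where "r = muR \<tau> p"
  define x' where "x' = x + v r"
  have b: "(r, x) \<in> base u a b" using p by (simp add: base_def level_iff pe r_def)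
  have zw: "z $ i * w $ i = theta \<tau> (x $ i)" for i using p by (simp add: pe level_iff)
  have r: "r $ i = moment \<tau> (z $ i) (w $ i) (x $ i)" for i by (simp add: r_def pe muR_nth)
  have x': "x' $ i = x $ i" if "r $ i = 0" for i using vz[OF that] by (simp add: x'_def)
  note tp = transport_properties[OF zw r x']
  have lf: "lift_complex \<tau> v p = (\<chi> i. transport_z \<tau> (r $ i) (z $ i) (w $ i) (x $ i) (x' $ i),
      \<chi> i. transport_w \<tau> (r $ i) (z $ i) (w $ i) (x $ i) (x' $ i), x')"
    by (simp add: lift_complex_def pe r_def Let_def x'_def)
  have mu: "muR \<tau> (lift_complex \<tau> v p) = r"
    using tp(2) by (simp add: lf vec_eq_iff muR_nth)
  have "lift_complex \<tau> v p \<in> level \<tau> u a b'"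
    using v[OF b, folded x'_def] b tp(1) unfolding lf level_iff by (simp add: mu[unfolded lf] base_def)
  moreover have "lift_complex \<tau> (\<lambda>r. - v r) (lift_complex \<tau> v p) = p"
    unfolding lift_complex_def[of \<tau> "\<lambda>r. - v r"] mu unfolding lf using tp(3,4)
    by (simp add: Let_def pe vec_eq_iff) (simp add: x'_def)
  ultimately show ?thesis by simp
qed

lemma lift_complex_act:
  assumes t: "\<And>i. cmod (t $ i) = 1"
  shows "lift_complex \<tau> v (act t p) = act t (lift_complex \<tau> v p)"
proof -
  obtain z w x where pe: "p = (z, w, x)" by (cases p)
  have mu: "muR \<tau> ((\<chi> i. t $ i * z $ i), (\<chi> i. inverse (t $ i) * w $ i), x) = muR \<tau> (z, w, x)"
    using muR_act[OF t, of \<tau> p] by (simp add: pe act_def)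
  show ?thesis
    by (simp add: pe act_def lift_complex_def Let_def mu)
      (simp add: fun_eq_iff transport_z_def transport_w_def divide_inverse inverse_mult_distrib mult_ac)
qed

text \<open>The lift preserves r and \<open>v\<close> depends on r only, so the lift of
  \<open>- v\<close> is the inverse and no equation has to be solved.\<close>

lemma Mtilde_homeomorphic_if_complex_move:
  fixes u :: "'n::finite \<Rightarrow> int^'d::finite" and v :: "real^'n \<Rightarrow> complex^'n"
  assumes \<tau>: "Im \<tau> > 0" and cont: "continuous_on UNIV v"
    and e: "e > 0" "\<And>r i. \<bar>r $ i\<bar> < e \<Longrightarrow> v r $ i = 0"
    and v: "\<And>r. iotaR_eq u r a \<Longrightarrow> iotaC_eq u (v r) (b' - b)"
  shows "Mtilde \<tau> u a b homeomorphic_space Mtilde \<tau> u a b'"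
proof -
  have v1: "iotaC_eq u (x + v r) b'" if "(r, x) \<in> base u a b" for r x
    using that v[of r] by (auto simp: base_def iotaC_eq_def algebra_simps sum.distrib sum_subtractf)
  have v2: "iotaC_eq u (x + - v r) b" if "(r, x) \<in> base u a b'" for r x
    using that v[of r] by (auto simp: base_def iotaC_eq_def algebra_simps sum.distrib sum_subtractf)
  have vz: "v r $ i = 0" if "r $ i = 0" for r i using e that by simp
  have cont': "continuous_on UNIV (\<lambda>r. - v r)" using cont by (intro continuous_intros)
  show ?thesis
  proof (rule Mtilde_homeomorphic_if_equivariant_homeomorphism[where f = "lift_complex \<tau> v" and g = "lift_complex \<tau> (\<lambda>r. - v r)"])
    show "continuous_on (level \<tau> u a b) (lift_complex \<tau> v)"
      by (rule continuous_on_lift_complex[OF \<tau> cont e])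
    show "continuous_on (level \<tau> u a b') (lift_complex \<tau> (\<lambda>r. - v r))"
      by (rule continuous_on_lift_complex[OF \<tau> cont' e(1)]) (simp add: e(2))
    show "lift_complex \<tau> v p \<in> level \<tau> u a b' \<and> lift_complex \<tau> (\<lambda>r. - v r) (lift_complex \<tau> v p) = p"
      if "p \<in> level \<tau> u a b" for p
      using lift_complex_level[OF that v1 vz] .
    show "lift_complex \<tau> (\<lambda>r. - v r) p \<in> level \<tau> u a b \<and> lift_complex \<tau> v (lift_complex \<tau> (\<lambda>r. - v r) p) = p"
      if "p \<in> level \<tau> u a b'" for p
      using lift_complex_level[OF that, of "\<lambda>r. - v r" b] v2 vz by simp
    show "lift_complex \<tau> v (act t p) = act t (lift_complex \<tau> v p)" if "\<And>i. cmod (t $ i) = 1" for p t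
      using lift_complex_act[OF that] .
  qed
qed

section \<open>Changing the parameters\<close>

text \<open>For fixed r' and x the preimage is the fixed point of r \<mapsto> r' - v(r, x), a
  contraction of the complete set \<open>S\<close>. The second variable is a parameter in which
  \<open>v\<close> is merely continuous.\<close>

lemma lipschitz_perturbation_inverse:
  fixes v :: "'a::banach \<times> 'b::metric_space \<Rightarrow> 'a"
  assumes S: "closed S" "S \<noteq> {}" and cont: "continuous_on (S \<times> T) v"
    and lip: "\<And>r s x. r \<in> S \<Longrightarrow> s \<in> S \<Longrightarrow> x \<in> T \<Longrightarrow> norm (v (r, x) - v (s, x)) \<le> norm (r - s) / 2"
    and shift: "\<And>r' r x. r' \<in> S' \<Longrightarrow> r \<in> S \<Longrightarrow> x \<in> T \<Longrightarrow> r' - v (r, x) \<in> S"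
  obtains \<psi> where "continuous_on (S' \<times> T) \<psi>"
    "\<And>r' x. r' \<in> S' \<Longrightarrow> x \<in> T \<Longrightarrow> \<psi> (r', x) \<in> S \<and> \<psi> (r', x) + v (\<psi> (r', x), x) = r'"
    "\<And>r x. r \<in> S \<Longrightarrow> x \<in> T \<Longrightarrow> r + v (r, x) \<in> S' \<Longrightarrow> \<psi> (r + v (r, x), x) = r"
proof -
  \<comment> \<open>A perturbation with Lipschitz constant 1/2 shrinks distances at most by half;
    this gives both uniqueness of the preimage and continuity of the inverse.\<close>
  have stable: "norm (r - s) \<le> 2 * norm ((r + v (r, x)) - (s + v (s, x)))"
    if "r \<in> S" "s \<in> S" "x \<in> T" for r s x
  proof -
    have "r - s = ((r + v (r, x)) - (s + v (s, x))) - (v (r, x) - v (s, x))" by simp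
    then have "norm (r - s) \<le> norm ((r + v (r, x)) - (s + v (s, x))) + norm (v (r, x) - v (s, x))"
      by (metis norm_triangle_ineq4)
    then show ?thesis using lip[OF that] by linarith
  qed
  have "\<exists>r\<in>S. r + v (r, x) = r'" if "r' \<in> S'" "x \<in> T" for r' x
  proof -
    have "\<exists>!r. r \<in> S \<and> r' - v (r, x) = r"
    proof (rule Banach_fix[of S "1/2"])
      show "complete S" using S(1) by (simp add: complete_eq_closed)
      show "(\<lambda>r. r' - v (r, x)) ` S \<subseteq> S" using shift that by auto
      show "dist (r' - v (r, x)) (r' - v (s, x)) \<le> 1 / 2 * dist r s" if "r \<in> S" "s \<in> S" for r s
        using lip[OF that \<open>x \<in> T\<close>] by (simp add: dist_norm norm_minus_commute)
    qed (use S in auto)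
    then show ?thesis by (metis diff_add_cancel)
  qed
  then obtain \<psi>0 where \<psi>0: "\<And>r' x. r' \<in> S' \<Longrightarrow> x \<in> T \<Longrightarrow> \<psi>0 r' x \<in> S \<and> \<psi>0 r' x + v (\<psi>0 r' x, x) = r'"
    by metis
  define \<psi> where "\<psi> = (\<lambda>(r', x). \<psi>0 r' x)"
  have \<psi>: "\<psi> (r', x) \<in> S" "\<psi> (r', x) + v (\<psi> (r', x), x) = r'" if "r' \<in> S'" "x \<in> T" for r' x
    using \<psi>0[OF that] by (auto simp: \<psi>_def)
  show ?thesis
  proof
    show "\<psi> (r', x) \<in> S \<and> \<psi> (r', x) + v (\<psi> (r', x), x) = r'" if "r' \<in> S'" "x \<in> T" for r' x
      using \<psi>[OF that] by simp
    show "\<psi> (r + v (r, x), x) = r" if "r \<in> S" "x \<in> T" "r + v (r, x) \<in> S'" for r x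
      using stable[of "\<psi> (r + v (r, x), x)" r x] \<psi>[OF that(3,2)] that by simp
    show "continuous_on (S' \<times> T) \<psi>"
      unfolding continuous_on_def
    proof
      fix q assume q: "q \<in> S' \<times> T"
      define s where "s = \<psi> q"
      have s: "s \<in> S" "s + v (s, snd q) = fst q" using \<psi>[of "fst q" "snd q"] q by (auto simp: s_def)
      have c: "continuous_on (S' \<times> T) (\<lambda>p. v (s, snd p))"
        by (rule continuous_on_compose2[OF cont]) (use s in \<open>auto intro!: continuous_intros\<close>)
      \<comment> \<open>With one argument of \<open>stable\<close> frozen at \<open>s\<close>, only
        the values of \<open>v\<close> at \<open>s\<close> for varying second variable have to be
        controlled.\<close>
      have "((\<lambda>p. \<psi> p - s) \<longlongrightarrow> 0) (at q within S' \<times> T)"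
      proof (rule Lim_null_comparison)
        show "\<forall>\<^sub>F p in at q within S' \<times> T. norm (\<psi> p - s) \<le> 2 * norm (fst p - (s + v (s, snd p)))"
        proof -
          have "norm (\<psi> p - s) \<le> 2 * norm (fst p - (s + v (s, snd p)))" if "p \<in> S' \<times> T" for p
            using stable[of "\<psi> p" s "snd p"] \<psi>[of "fst p" "snd p"] that s(1) by auto
          then show ?thesis by (simp add: eventually_at_filter)
        qed
        have "((\<lambda>p. v (s, snd p)) \<longlongrightarrow> v (s, snd q)) (at q within S' \<times> T)"
          using c q by (auto simp: continuous_on_def)
        then have "((\<lambda>p. 2 * norm (fst p - (s + v (s, snd p)))) \<longlongrightarrow>
            2 * norm (fst q - (s + v (s, snd q)))) (at q within S' \<times> T)"
          by (intro tendsto_intros) auto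
        then show "((\<lambda>p. 2 * norm (fst p - (s + v (s, snd p)))) \<longlongrightarrow> 0) (at q within S' \<times> T)"
          using s(2) by simp
      qed
      then show "(\<psi> \<longlongrightarrow> \<psi> q) (at q within S' \<times> T)" unfolding s_def by (rule LIM_zero_cancel)
    qed
  qed
qed

text \<open>For \<open>e > 0\<close> it rises linearly from 0 at \<open>e / 2\<close> to 1 at
  \<open>e\<close>, so its slope is \<open>2 / e\<close>.\<close>

definition cutoff :: "real \<Rightarrow> real \<Rightarrow> real" where
  "cutoff e r = max 0 (min 1 (2 * \<bar>r\<bar> / e - 1))"

lemma cutoff_range: "0 \<le> cutoff e r" "cutoff e r \<le> 1"
  by (auto simp: cutoff_def)

lemma cutoff_eq_0: "e > 0 \<Longrightarrow> \<bar>r\<bar> \<le> e / 2 \<Longrightarrow> cutoff e r = 0"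
  by (auto simp: cutoff_def field_simps)

lemma abs_less_if_cutoff_less_1: "e > 0 \<Longrightarrow> cutoff e r < 1 \<Longrightarrow> \<bar>r\<bar> < e"
  by (auto simp: cutoff_def field_simps max_def min_def split: if_splits)

lemma cutoff_lipschitz:
  assumes "e > 0"
  shows "\<bar>cutoff e r - cutoff e s\<bar> \<le> 2 / e * \<bar>r - s\<bar>"
proof -
  have clamp: "\<bar>max 0 (min 1 x) - max 0 (min 1 y)\<bar> \<le> \<bar>x - y\<bar>" for x y :: real
    by (auto simp: max_def min_def)
  have "\<bar>cutoff e r - cutoff e s\<bar> \<le> \<bar>(2 * \<bar>r\<bar> / e - 1) - (2 * \<bar>s\<bar> / e - 1)\<bar>"
    unfolding cutoff_def by (rule clamp)
  also have "\<dots> = \<bar>2 * \<bar>r\<bar> / e - 2 * \<bar>s\<bar> / e\<bar>" by simp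
  also have "\<dots> = 2 / e * \<bar>\<bar>r\<bar> - \<bar>s\<bar>\<bar>"
  proof -
    have "2 * \<bar>r\<bar> / e - 2 * \<bar>s\<bar> / e = 2 / e * (\<bar>r\<bar> - \<bar>s\<bar>)"
      by (simp add: right_diff_distrib diff_divide_distrib)
    then show ?thesis using assms by (simp only: abs_mult) simp
  qed
  also have "\<dots> \<le> 2 / e * \<bar>r - s\<bar>" using assms by (intro mult_left_mono) auto
  finally show ?thesis .
qed

lemma continuous_on_cutoff [continuous_intros]:
  "continuous_on A f \<Longrightarrow> continuous_on A (\<lambda>p. cutoff e (f p))"
  unfolding cutoff_def divide_inverse by (intro continuous_intros)

lemma sum_mult_matrix_iotaC:
  assumes D: "\<And>\<xi> j. \<xi> \<in> kR u \<Longrightarrow> (\<Sum>i\<in>UNIV. \<xi> $ i * D i j) = \<xi> $ j"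
  shows "iotaC_eq u (\<chi> i. \<Sum>j\<in>UNIV. complex_of_real (D i j) * \<delta> $ j) \<delta>"
  unfolding iotaC_eq_def
proof
  fix \<zeta> assume "\<zeta> \<in> kC u"
  then have k: "(\<chi> i. Re (\<zeta> $ i)) \<in> kR u" "(\<chi> i. Im (\<zeta> $ i)) \<in> kR u" by (auto simp: kC_iff)
  have col: "(\<Sum>i\<in>UNIV. \<zeta> $ i * complex_of_real (D i j)) = \<zeta> $ j" for j
    using D[OF k(1), of j] D[OF k(2), of j] by (simp add: complex_eq_iff Re_sum Im_sum)
  have "(\<Sum>i\<in>UNIV. (\<chi> i. \<Sum>j\<in>UNIV. complex_of_real (D i j) * \<delta> $ j) $ i * \<zeta> $ i) =
      (\<Sum>i\<in>UNIV. \<Sum>j\<in>UNIV. \<delta> $ j * (\<zeta> $ i * complex_of_real (D i j)))"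
    by (simp add: sum_distrib_left sum_distrib_right mult_ac)
  also have "\<dots> = (\<Sum>j\<in>UNIV. \<delta> $ j * (\<Sum>i\<in>UNIV. \<zeta> $ i * complex_of_real (D i j)))"
    by (subst sum.swap) (simp add: sum_distrib_left)
  also have "\<dots> = (\<Sum>j\<in>UNIV. \<delta> $ j * \<zeta> $ j)" by (simp only: col)
  finally show "(\<Sum>i\<in>UNIV. (\<chi> i. \<Sum>j\<in>UNIV. complex_of_real (D i j) * \<delta> $ j) $ i * \<zeta> $ i) =
      (\<Sum>i\<in>UNIV. \<delta> $ i * \<zeta> $ i)" .
qed

lemma sum_mult_matrix_iotaR:
  assumes D: "\<And>\<xi> j. \<xi> \<in> kR u \<Longrightarrow> (\<Sum>i\<in>UNIV. \<xi> $ i * D i j) = \<xi> $ j"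
  shows "iotaR_eq u (\<chi> i. \<Sum>j\<in>UNIV. D i j * \<delta> $ j) \<delta>"
  unfolding iotaR_eq_def
proof
  fix \<xi> assume k: "\<xi> \<in> kR u"
  have "(\<Sum>i\<in>UNIV. (\<chi> i. \<Sum>j\<in>UNIV. D i j * \<delta> $ j) $ i * \<xi> $ i) =
      (\<Sum>i\<in>UNIV. \<Sum>j\<in>UNIV. \<delta> $ j * (\<xi> $ i * D i j))"
    by (simp add: sum_distrib_left sum_distrib_right mult_ac)
  also have "\<dots> = (\<Sum>j\<in>UNIV. \<delta> $ j * (\<Sum>i\<in>UNIV. \<xi> $ i * D i j))"
    by (subst sum.swap) (simp add: sum_distrib_left)
  also have "\<dots> = (\<Sum>j\<in>UNIV. \<delta> $ j * \<xi> $ j)" by (simp only: D[OF k])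
  finally show "(\<Sum>i\<in>UNIV. (\<chi> i. \<Sum>j\<in>UNIV. D i j * \<delta> $ j) $ i * \<xi> $ i) = (\<Sum>i\<in>UNIV. \<delta> $ i * \<xi> $ i)" .
qed

text \<open>Coordinates with small r stay fixed, and the others absorb the shift b' - b. This is
  possible at every r because the small coordinates are independent, whatever x is.\<close>

lemma complex_parameter_irrelevant:
  fixes u :: "'n::finite \<Rightarrow> int^'d::finite"
  assumes \<tau>: "Im \<tau> > 0" and a: "transversal_R u a"
  shows "Mtilde \<tau> u a b homeomorphic_space Mtilde \<tau> u a b'"
proof -
  obtain e where e: "e > 0"
    "\<And>r. iotaR_eq u r a \<Longrightarrow> \<exists>s. iotaR_eq u s a \<and> (\<forall>i. \<bar>r $ i\<bar> < e \<longrightarrow> s $ i = 0)"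
    using small_coordinates_vanish_simultaneously[of u a] by blast
  obtain D :: "real^'n \<Rightarrow> 'n \<Rightarrow> 'n \<Rightarrow> real" where
    D: "\<And>G \<xi> j. no_relation_on u {i. G $ i \<noteq> 1} \<Longrightarrow> \<xi> \<in> kR u \<Longrightarrow> (\<Sum>i\<in>UNIV. \<xi> $ i * D G i j) = \<xi> $ j"
      "\<And>G i j. G $ i = 0 \<Longrightarrow> D G i j = 0" "\<And>i j. continuous_on UNIV (\<lambda>G. D G i j)"
  proof (rule correction_matrix_family[of u], goal_cases)
    case (1 D C)
    from 1(3,4,7) show ?case by (rule 1(1))
  qed
  define G where "G = (\<lambda>r :: real^'n. \<chi> i. cutoff e (r $ i))"
  define v where "v = (\<lambda>r. \<chi> i. \<Sum>j\<in>UNIV. complex_of_real (D (G r) i j) * (b' - b) $ j)"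
  show ?thesis
  proof (rule Mtilde_homeomorphic_if_complex_move[OF \<tau>])
    have "continuous_on UNIV G" unfolding G_def by (intro continuous_on_vec_lambda continuous_intros)
    then have "continuous_on UNIV (\<lambda>r. D (G r) i j)" for i j
      by (rule continuous_on_compose2[OF D(3)]) auto
    then show "continuous_on UNIV v" unfolding v_def
      by (intro continuous_on_vec_lambda continuous_intros)
    show "e / 2 > 0" using e by simp
    show "v r $ i = 0" if "\<bar>r $ i\<bar> < e / 2" for r i
      using that cutoff_eq_0[OF e(1)] by (simp add: v_def D(2) G_def)
    show "iotaC_eq u (v r) (b' - b)" if r: "iotaR_eq u r a" for r
      unfolding v_def
    proof (intro sum_mult_matrix_iotaC D(1))
      \<comment> \<open>Since r need not vanish at its small coordinates, transversality is applied
        to \<open>s\<close>, whose zero set contains every \<open>i\<close> where the cutoff is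
        below 1.\<close>
      obtain s where s: "iotaR_eq u s a" "\<And>i. \<bar>r $ i\<bar> < e \<Longrightarrow> s $ i = 0" using e(2)[OF r] by blast
      have "no_relation_on u {i. s $ i = 0}" using a s(1) by (simp add: transversal_R_def)
      then show "no_relation_on u {i. G r $ i \<noteq> 1}"
        by (rule no_relation_on_subset)
          (use s(2) abs_less_if_cutoff_less_1[OF e(1)] cutoff_range(2)[of e] in \<open>auto simp: G_def less_le\<close>)
    qed
  qed
qed

lemma closed_iotaR_eq: "closed {r. iotaR_eq u r a}"
proof -
  have "{r. iotaR_eq u r a} = (\<Inter>\<xi>\<in>kR u. {r. r \<bullet> \<xi> = a \<bullet> \<xi>})" by (auto simp: iotaR_eq_inner)
  then show ?thesis by (auto intro!: closed_INT closed_Collect_eq continuous_intros)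
qed

definition generic_parameters :: "complex \<Rightarrow> ('n::finite \<Rightarrow> int^'d::finite) \<Rightarrow> real^'n \<Rightarrow> complex^'n \<Rightarrow> bool" where
  "generic_parameters \<tau> u a b \<longleftrightarrow>
     (\<forall>(r, x)\<in>base u a b. no_relation_on u {i. r $ i = 0 \<and> theta \<tau> (x $ i) = 0})"

text \<open>\<open>M\<close> is a product of averages of \<open>\<bar>theta (x\<^sub>i)\<bar>\<close>, one for each set of dependent coordinates on
  which \<open>r\<close> can vanish; genericity says that none of these averages is zero.\<close>
lemma generic_separation:
  fixes u :: "'n::finite \<Rightarrow> int^'d::finite"
  assumes \<tau>: "Im \<tau> > 0" and gen: "generic_parameters \<tau> u a b"
  obtains M :: "complex^'n \<Rightarrow> real" where "continuous_on UNIV M"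
    "\<And>x. M x \<ge> 0" "\<And>x. iotaC_eq u x b \<Longrightarrow> M x > 0"
    "\<And>x s. iotaR_eq u s a \<Longrightarrow> no_relation_on u {i. s $ i = 0 \<and> cmod (theta \<tau> (x $ i)) < M x}"
proof -
  define bad where "bad = {J. \<not> no_relation_on u J \<and> (\<exists>s. iotaR_eq u s a \<and> (\<forall>i\<in>J. s $ i = 0))}"
  \<comment> \<open>Truncation at 1 bounds the product \<open>M\<close> by each of its factors.
    Since \<open>J\<close> has at most \<open>CARD('n)\<close> elements,
    \<open>cmod (theta \<tau> (x $ i)) < M x\<close> on all of \<open>J\<close> would push the
    average below \<open>M x\<close>.\<close>
  define f where "f = (\<lambda>J (x :: complex^'n). min 1 ((\<Sum>i\<in>J. cmod (theta \<tau> (x $ i))) / CARD('n)))"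
  have f01: "0 \<le> f J x" "f J x \<le> 1" for J x by (auto simp: f_def sum_nonneg)
  define M where "M = (\<lambda>x. \<Prod>J\<in>bad. f J x)"
  show ?thesis
  proof
    show "continuous_on UNIV M" unfolding M_def f_def
      by (intro continuous_intros continuous_on_theta \<tau>) auto
    show "M x \<ge> 0" for x unfolding M_def using f01 by (intro prod_nonneg) auto
    show "M x > 0" if x: "iotaC_eq u x b" for x
      unfolding M_def
    proof (rule prod_pos)
      fix J assume "J \<in> bad"
      then obtain s where s: "\<not> no_relation_on u J" "iotaR_eq u s a" "\<forall>i\<in>J. s $ i = 0"
        by (auto simp: bad_def)
      have "no_relation_on u {i. s $ i = 0 \<and> theta \<tau> (x $ i) = 0}"
        using gen s(2) x by (auto simp: generic_parameters_def base_def)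
      then have "\<not> J \<subseteq> {i. s $ i = 0 \<and> theta \<tau> (x $ i) = 0}" using s(1) no_relation_on_subset by blast
      then obtain i where "i \<in> J" "theta \<tau> (x $ i) \<noteq> 0" using s(3) by blast
      then have "(\<Sum>i\<in>J. cmod (theta \<tau> (x $ i))) > 0" by (intro sum_pos2[of J i]) auto
      then show "f J x > 0" by (simp add: f_def)
    qed
    show "no_relation_on u {i. s $ i = 0 \<and> cmod (theta \<tau> (x $ i)) < M x}" if s: "iotaR_eq u s a" for x s
    proof (rule ccontr)
      define J where "J = {i. s $ i = 0 \<and> cmod (theta \<tau> (x $ i)) < M x}"
      assume "\<not> no_relation_on u {i. s $ i = 0 \<and> cmod (theta \<tau> (x $ i)) < M x}"
      then have J: "\<not> no_relation_on u J" by (simp add: J_def)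
      then have bad: "J \<in> bad" using s by (auto simp: bad_def J_def)
      have "J \<noteq> {}" using J by (auto simp: no_relation_on_def vec_eq_iff)
      have "M x = f J x * (\<Prod>K\<in>bad - {J}. f K x)"
        unfolding M_def by (rule prod.remove) (use bad in auto)
      also have "\<dots> \<le> f J x * 1" using f01 by (intro mult_left_mono prod_le_1) auto
      also have "\<dots> \<le> (\<Sum>i\<in>J. cmod (theta \<tau> (x $ i))) / CARD('n)" by (simp add: f_def)
      finally have "CARD('n) * M x \<le> (\<Sum>i\<in>J. cmod (theta \<tau> (x $ i)))" by (simp add: field_simps)
      also have "\<dots> < (\<Sum>i\<in>J. M x)" using \<open>J \<noteq> {}\<close> by (intro sum_strict_mono) (auto simp: J_def)
      also have "\<dots> = card J * M x" by simp
      also have "\<dots> \<le> CARD('n) * M x"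
        using f01 by (intro mult_right_mono) (auto simp: M_def card_mono intro!: prod_nonneg)
      finally show False by simp
    qed
  qed
qed

lemma small_real_move:
  fixes u :: "'n::finite \<Rightarrow> int^'d::finite"
  assumes \<tau>: "Im \<tau> > 0" and gen: "generic_parameters \<tau> u a b"
  obtains d where "d > 0" "\<And>a'. dist a a' < d \<Longrightarrow> Mtilde \<tau> u a b homeomorphic_space Mtilde \<tau> u a' b"
proof -
  obtain e where e: "e > 0"
    "\<And>r. iotaR_eq u r a \<Longrightarrow> \<exists>s. iotaR_eq u s a \<and> (\<forall>i. \<bar>r $ i\<bar> < e \<longrightarrow> s $ i = 0)"
    using small_coordinates_vanish_simultaneously[of u a] by blast
  obtain D :: "real^'n \<Rightarrow> 'n \<Rightarrow> 'n \<Rightarrow> real" and C :: real where C: "C > 0" and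
    D: "\<And>G \<xi> j. no_relation_on u {i. G $ i \<noteq> 1} \<Longrightarrow> \<xi> \<in> kR u \<Longrightarrow> (\<Sum>i\<in>UNIV. \<xi> $ i * D G i j) = \<xi> $ j"
      "\<And>G i j. G $ i = 0 \<Longrightarrow> D G i j = 0"
      "\<And>G i j. \<forall>i. G $ i \<in> {0..1} \<Longrightarrow> \<bar>D G i j\<bar> \<le> C"
      "\<And>G G' i j. \<forall>i. G $ i \<in> {0..1} \<Longrightarrow> \<forall>i. G' $ i \<in> {0..1} \<Longrightarrow>
        \<bar>D G i j - D G' i j\<bar> \<le> C * (\<Sum>k\<in>UNIV. \<bar>G $ k - G' $ k\<bar>)"
      "\<And>i j. continuous_on UNIV (\<lambda>G. D G i j)"
  proof (rule correction_matrix_family[of u], goal_cases)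
    case (1 D C)
    from 1(2-7) show ?case by (rule 1(1))
  qed
  obtain M where M: "continuous_on UNIV M" "\<And>x. M x \<ge> 0" "\<And>x. iotaC_eq u x b \<Longrightarrow> M x > 0"
    "\<And>x s. iotaR_eq u s a \<Longrightarrow> no_relation_on u {i. s $ i = 0 \<and> cmod (theta \<tau> (x $ i)) < M x}"
  proof (rule generic_separation[OF \<tau> gen], goal_cases)
    case (1 M)
    from 1(2-5) show ?case by (rule 1(1))
  qed
  define n where "n = real CARD('n)"
  have n: "n \<ge> 1" by (simp add: n_def Suc_leI)
  \<comment> \<open>\<open>G \<noteq> 1\<close> forces both r and theta to be small in that
    coordinate, which yields independence; \<open>G = 0\<close> holds where theta vanishes and |r|
    is at most \<open>e / 2\<close>, which fixes that coordinate. As x enters only through the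
    second argument of \<open>max\<close>, the Lipschitz constant in r is that of the cutoff,
    however small \<open>M x\<close> is.\<close>
  define G where "G = (\<lambda>(r :: real^'n, x :: complex^'n).
      \<chi> i. max (cutoff e (r $ i)) (min 1 (cmod (theta \<tau> (x $ i)) / M x)))"
  have G01: "\<forall>i. G q $ i \<in> {0..1}" for q
    using cutoff_range[of e] M(2) by (auto simp: G_def max.coboundedI1 split: prod.split)
  have Gno: "no_relation_on u {i. G (r, x) $ i \<noteq> 1}" if rx: "(r, x) \<in> base u a b" for r x
  proof -
    obtain s where s: "iotaR_eq u s a" "\<And>i. \<bar>r $ i\<bar> < e \<Longrightarrow> s $ i = 0"
      using e(2)[of r] rx by (auto simp: base_def)
    have Mx: "M x > 0" using M(3) rx by (auto simp: base_def)
    have "s $ i = 0 \<and> cmod (theta \<tau> (x $ i)) < M x" if "G (r, x) $ i \<noteq> 1" for i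
    proof -
      have "G (r, x) $ i < 1" using that G01[of "(r, x)"] by (simp add: less_le)
      then have "cutoff e (r $ i) < 1" "cmod (theta \<tau> (x $ i)) / M x < 1" by (auto simp: G_def)
      then show ?thesis using s(2) abs_less_if_cutoff_less_1[OF e(1)] Mx by auto
    qed
    then show ?thesis by (intro no_relation_on_subset[OF M(4)[OF s(1), of x]]) auto
  qed
  have max_lip: "\<bar>max x c - max y c\<bar> \<le> \<bar>x - y\<bar>" for x y c :: real
    by (auto simp: max_def)
  have Glip: "(\<Sum>k\<in>UNIV. \<bar>G (r, x) $ k - G (s, x) $ k\<bar>) \<le> 2 / e * n * norm (r - s)" for r s x
  proof -
    have "\<bar>G (r, x) $ k - G (s, x) $ k\<bar> \<le> 2 / e * norm (r - s)" for k
    proof -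
      have "\<bar>G (r, x) $ k - G (s, x) $ k\<bar> \<le> \<bar>cutoff e (r $ k) - cutoff e (s $ k)\<bar>"
        unfolding G_def by (simp add: max_lip)
      also have "\<dots> \<le> 2 / e * \<bar>(r - s) $ k\<bar>" using cutoff_lipschitz[OF e(1)] by simp
      also have "\<dots> \<le> 2 / e * norm (r - s)" using e(1) component_le_norm_cart[of "r - s" k]
        by (intro mult_left_mono) auto
      finally show ?thesis .
    qed
    then have "(\<Sum>k\<in>UNIV. \<bar>G (r, x) $ k - G (s, x) $ k\<bar>) \<le> (\<Sum>k\<in>(UNIV :: 'n set). 2 / e * norm (r - s))"
      by (rule sum_mono)
    then show ?thesis by (simp add: n_def mult_ac)
  qed
  have Gcont: "continuous_on (base u a b) G"
  proof -
    have "continuous_on (base u a b) (\<lambda>q. M (snd q))"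
      by (rule continuous_on_compose2[OF M(1)]) (auto intro!: continuous_intros)
    moreover have "M (snd q) \<noteq> 0" if "q \<in> base u a b" for q using M(3)[of "snd q"] that by (auto simp: base_def)
    ultimately show ?thesis unfolding G_def case_prod_unfold
      by (intro continuous_on_vec_lambda continuous_intros continuous_on_theta \<tau>) auto
  qed
  \<comment> \<open>In the Lipschitz estimate one factor \<open>n\<close> comes from the coordinates
    of \<open>G\<close>, one from those of \<delta>, and one from comparing the norm with the sum of
    coordinates; the total is 1/2. The same \<open>d\<close> bounds each coordinate of
    \<open>v\<close> by \<open>e / 4\<close>.\<close>
  define d where "d = e / (4 * C * n ^ 3)"
  have d: "d > 0" using e(1) C n by (simp add: d_def)
  show ?thesis
  proof (rule that[OF d])
    fix a' assume close: "dist a a' < d"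
    define \<delta> where "\<delta> = a' - a"
    have \<delta>: "norm \<delta> \<le> d" using close by (simp add: \<delta>_def dist_norm norm_minus_commute)
    have sum\<delta>: "(\<Sum>j\<in>UNIV. \<bar>\<delta> $ j\<bar>) \<le> n * d"
    proof -
      have "(\<Sum>j\<in>UNIV. \<bar>\<delta> $ j\<bar>) \<le> (\<Sum>j\<in>(UNIV :: 'n set). d)"
        using \<delta> component_le_norm_cart[of \<delta>] order_trans by (intro sum_mono) blast
      then show ?thesis by (simp add: n_def)
    qed
    define v where "v = (\<lambda>q. \<chi> i. \<Sum>j\<in>UNIV. D (G q) i j * \<delta> $ j)"
    have vcont: "continuous_on (base u a b) v"
    proof -
      have "continuous_on (base u a b) (\<lambda>q. D (G q) i j)" for i j
        by (rule continuous_on_compose2[OF D(5) Gcont]) auto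
      then show ?thesis unfolding v_def by (intro continuous_on_vec_lambda continuous_intros)
    qed
    have vbound: "\<bar>v q $ i\<bar> \<le> e / 4" for q i
    proof -
      have "\<bar>v q $ i\<bar> \<le> (\<Sum>j\<in>UNIV. \<bar>D (G q) i j\<bar> * \<bar>\<delta> $ j\<bar>)"
        unfolding v_def abs_mult[symmetric] by simp
      also have "\<dots> \<le> (\<Sum>j\<in>UNIV. C * \<bar>\<delta> $ j\<bar>)" by (intro sum_mono mult_right_mono D(3) G01) auto
      also have "\<dots> \<le> C * (n * d)" unfolding sum_distrib_left[symmetric]
        using sum\<delta> C by (intro mult_left_mono) auto
      also have "\<dots> = e / 4 / n\<^sup>2" using C n by (simp add: d_def field_simps power2_eq_square power3_eq_cube)
      also have "\<dots> \<le> e / 4 / 1" using n e(1) by (intro divide_left_mono) auto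
      finally show ?thesis by simp
    qed
    have vlip: "norm (v (r, x) - v (s, x)) \<le> norm (r - s) / 2" for r s x
    proof -
      have "\<bar>(v (r, x) - v (s, x)) $ i\<bar> \<le> norm (r - s) / (2 * n)" for i
      proof -
        have "(v (r, x) - v (s, x)) $ i = (\<Sum>j\<in>UNIV. (D (G (r, x)) i j - D (G (s, x)) i j) * \<delta> $ j)"
          by (simp add: v_def left_diff_distrib sum_subtractf)
        also have "\<bar>\<dots>\<bar> \<le> (\<Sum>j\<in>UNIV. \<bar>D (G (r, x)) i j - D (G (s, x)) i j\<bar> * \<bar>\<delta> $ j\<bar>)"
          unfolding abs_mult[symmetric] by (rule sum_abs)
        also have "\<dots> \<le> (\<Sum>j\<in>UNIV. (C * (2 / e * n * norm (r - s))) * \<bar>\<delta> $ j\<bar>)"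
        proof (intro sum_mono mult_right_mono)
          fix j
          have "\<bar>D (G (r, x)) i j - D (G (s, x)) i j\<bar> \<le> C * (\<Sum>k\<in>UNIV. \<bar>G (r, x) $ k - G (s, x) $ k\<bar>)"
            by (rule D(4)[OF G01 G01])
          also have "\<dots> \<le> C * (2 / e * n * norm (r - s))" using Glip C by (intro mult_left_mono) auto
          finally show "\<bar>D (G (r, x)) i j - D (G (s, x)) i j\<bar> \<le> C * (2 / e * n * norm (r - s))" .
        qed auto
        also have "\<dots> \<le> (C * (2 / e * n * norm (r - s))) * (n * d)" unfolding sum_distrib_left[symmetric]
          using sum\<delta> C e(1) n by (intro mult_left_mono) auto
        also have "\<dots> = norm (r - s) / (2 * n)"
          using C e(1) n by (simp add: d_def field_simps power3_eq_cube)
        finally show ?thesis .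
      qed
      then have "(\<Sum>i\<in>UNIV. \<bar>(v (r, x) - v (s, x)) $ i\<bar>) \<le> (\<Sum>i\<in>(UNIV :: 'n set). norm (r - s) / (2 * n))"
        by (rule sum_mono)
      also have "\<dots> = norm (r - s) / 2" using n by (simp add: n_def)
      finally show ?thesis using norm_le_l1_cart[of "v (r, x) - v (s, x)"] by linarith
    qed
    have viota: "iotaR_eq u (v (r, x)) \<delta>" if "(r, x) \<in> base u a b" for r x
      unfolding v_def by (intro sum_mult_matrix_iotaR D(1) Gno that)
    define S S' T where "S = {r. iotaR_eq u r a}" and "S' = {r. iotaR_eq u r a'}" and "T = {x. iotaC_eq u x b}"
    have ST: "base u a b = S \<times> T" "base u a' b = S' \<times> T" by (auto simp: base_def S_def S'_def T_def)
    have fwd: "r + v (r, x) \<in> S'" if "(r, x) \<in> base u a b" for r x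
      using viota[OF that] that by (auto simp: S'_def base_def iotaR_eq_inner \<delta>_def inner_add_left inner_diff_left)
    \<comment> \<open>At every base point \<open>v\<close> restricts to the same functional as
      \<delta>, so subtracting any of its values carries \<open>S'\<close> into \<open>S\<close>;
      the fixed-point map thus stays in \<open>S\<close>.\<close>
    have bwd: "r' - v (r, x) \<in> S" if "r' \<in> S'" "r \<in> S" "x \<in> T" for r' r x
      using viota[of r x] that
      by (auto simp: S_def S'_def T_def base_def iotaR_eq_inner \<delta>_def inner_add_left inner_diff_left)
    obtain \<psi> where \<psi>: "continuous_on (S' \<times> T) \<psi>"
      "\<And>r' x. r' \<in> S' \<Longrightarrow> x \<in> T \<Longrightarrow> \<psi> (r', x) \<in> S \<and> \<psi> (r', x) + v (\<psi> (r', x), x) = r'"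
      "\<And>r x. r \<in> S \<Longrightarrow> x \<in> T \<Longrightarrow> r + v (r, x) \<in> S' \<Longrightarrow> \<psi> (r + v (r, x), x) = r"
    proof (rule lipschitz_perturbation_inverse[of S T v S'])
      show "closed S" unfolding S_def by (rule closed_iotaR_eq)
      show "S \<noteq> {}" unfolding S_def iotaR_eq_def by auto
    qed (use vcont ST vlip bwd in auto)
    define \<phi> where "\<phi> = (\<lambda>q. fst q + v q)"
    show "Mtilde \<tau> u a b homeomorphic_space Mtilde \<tau> u a' b"
    proof (rule Mtilde_homeomorphic_if_real_move[OF \<tau>, where \<phi> = \<phi> and \<psi> = \<psi>])
      show "continuous_on (base u a b) \<phi>" unfolding \<phi>_def by (intro continuous_intros vcont)
      show "continuous_on (base u a' b) \<psi>" using \<psi>(1) ST by simp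
      show "(\<phi> (r, x), x) \<in> base u a' b \<and> \<psi> (\<phi> (r, x), x) = r" if "(r, x) \<in> base u a b" for r x
        using fwd[OF that] \<psi>(3)[of r x] that by (auto simp: \<phi>_def ST)
      show "(\<psi> (r, x), x) \<in> base u a b \<and> \<phi> (\<psi> (r, x), x) = r" if "(r, x) \<in> base u a' b" for r x
        using \<psi>(2)[of r x] that by (auto simp: \<phi>_def ST)
      show "sgn (\<phi> (r, x) $ i) = sgn (r $ i)" if "(r, x) \<in> base u a b" "theta \<tau> (x $ i) = 0" for r x i
      \<comment> \<open>At a zero of theta the coordinate either does not move or moves by at most
        \<open>e / 4\<close>, less than its absolute value.\<close>
      proof (cases "\<bar>r $ i\<bar> \<le> e / 2")
        case True
        then have "G (r, x) $ i = 0" using that(2) cutoff_eq_0[OF e(1)] by (simp add: G_def)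
        then show ?thesis by (simp add: \<phi>_def v_def D(2))
      next
        case False
        then show ?thesis using vbound[of "(r, x)" i] e(1) by (auto simp: \<phi>_def sgn_if abs_if split: if_splits)
      qed
    qed
  qed
qed

lemma real_parameter_irrelevant:
  assumes \<tau>: "Im \<tau> > 0" and b: "transversal_C \<tau> u b"
  shows "Mtilde \<tau> u a b homeomorphic_space Mtilde \<tau> u a' b"
proof (rule connected_equivalence_relation[of UNIV a a' "\<lambda>a a'. Mtilde \<tau> u a b homeomorphic_space Mtilde \<tau> u a' b"])
  fix c
  have "generic_parameters \<tau> u c b"
    using b unfolding generic_parameters_def transversal_C_def base_def
    by (auto intro: no_relation_on_subset)
  then obtain d where "d > 0" "\<And>a'. dist c a' < d \<Longrightarrow> Mtilde \<tau> u c b homeomorphic_space Mtilde \<tau> u a' b"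
    using small_real_move[OF \<tau>] by metis
  then show "\<exists>T. openin (top_of_set UNIV) T \<and> c \<in> T \<and>
      (\<forall>x\<in>T. Mtilde \<tau> u c b homeomorphic_space Mtilde \<tau> u x b)"
    by (intro exI[of _ "ball c d"]) auto
next
  show "Mtilde \<tau> u y b homeomorphic_space Mtilde \<tau> u x b"
    if "Mtilde \<tau> u x b homeomorphic_space Mtilde \<tau> u y b" for x y
    using that by (rule homeomorphic_space_sym[THEN iffD1])
  show "Mtilde \<tau> u x b homeomorphic_space Mtilde \<tau> u z b"
    if "Mtilde \<tau> u x b homeomorphic_space Mtilde \<tau> u y b"
      "Mtilde \<tau> u y b homeomorphic_space Mtilde \<tau> u z b" for x y z
    using that by (rule homeomorphic_space_trans)
qed (simp_all add: convex_connected)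

section \<open>Critical points of the real moment map\<close>

lemma muR_derivative_zero:
  assumes D: "(muR \<tau> has_derivative D) (at (z, w, x))" and "z $ i = 0" "w $ i = 0"
  shows "D v $ i = 0"
proof -
  have d: "((\<lambda>p. muR \<tau> p $ i) has_derivative (\<lambda>v. D v $ i)) (at (z, w, x))"
    using bounded_linear.has_derivative[OF bounded_linear_vec_nth D] .
  \<comment> \<open>With squared norms written as inner products, the component is quadratic in the
    two fibre coordinates, with a weight depending on x; it has no first-order term where both
    vanish.\<close>
  have d0: "((\<lambda>p. (1/2) * ((fst p $ i) \<bullet> (fst p $ i) -
      exp (- 2 * pi / Im \<tau> * (Im (snd (snd p) $ i))\<^sup>2) * ((fst (snd p) $ i) \<bullet> (fst (snd p) $ i))))
      has_derivative (\<lambda>v. 0)) (at (z, w, x))"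
  proof -
    note nth = bounded_linear_compose[OF bounded_linear_vec_nth]
    have z: "((\<lambda>p :: 'a pt. fst p $ i) has_derivative (\<lambda>v. fst v $ i)) (at (z, w, x))"
      by (rule bounded_linear_imp_has_derivative[OF nth[OF bounded_linear_fst]])
    have w: "((\<lambda>p :: 'a pt. fst (snd p) $ i) has_derivative (\<lambda>v. fst (snd v) $ i)) (at (z, w, x))"
      by (rule bounded_linear_imp_has_derivative[OF
            nth[OF bounded_linear_compose[OF bounded_linear_fst bounded_linear_snd]]])
    have x: "((\<lambda>p :: 'a pt. Im (snd (snd p) $ i)) has_derivative (\<lambda>v. Im (snd (snd v) $ i))) (at (z, w, x))"
      by (rule bounded_linear_imp_has_derivative[OF bounded_linear_compose[OF bounded_linear_Im
            nth[OF bounded_linear_compose[OF bounded_linear_snd bounded_linear_snd]]]])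
    show ?thesis
      by (rule has_derivative_eq_rhs[OF has_derivative_mult_right[OF has_derivative_diff[OF
            has_derivative_inner[OF z z] has_derivative_mult[OF
            has_derivative_exp[OF has_derivative_mult_right[OF has_derivative_power[OF x]]]
            has_derivative_inner[OF w w]]]]])
        (simp add: assms(2,3))
  qed
  have "(\<lambda>p :: 'a pt. muR \<tau> p $ i) = (\<lambda>p. (1/2) * ((fst p $ i) \<bullet> (fst p $ i) -
      exp (- 2 * pi / Im \<tau> * (Im (snd (snd p) $ i))\<^sup>2) * ((fst (snd p) $ i) \<bullet> (fst (snd p) $ i))))"
    by (simp add: muR_def fun_eq_iff power2_norm_eq_inner case_prod_unfold)
  then have "(\<lambda>v. D v $ i) = (\<lambda>v. 0)" using has_derivative_unique[OF d] d0 by simp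
  then show ?thesis by (rule fun_cong)
qed

text \<open>Above a base point, \<open>z\<close> and \<open>w\<close> vanish in every coordinate
  where r and theta do. A relation \<xi> supported there annihilates the differential of the real
  moment map; surjectivity, tested on the functional \<xi> itself, gives
  \<open>\<xi> \<bullet> \<xi> = 0\<close>.\<close>

lemma regular_value_imp_generic:
  assumes reg: "regular_value \<tau> u a b"
  shows "generic_parameters \<tau> u a b"
  unfolding generic_parameters_def
proof clarify
  fix r x assume rx: "(r, x) \<in> base u a b"
  have "\<exists>z w. z * w = theta \<tau> (x $ i) \<and> moment \<tau> z w (x $ i) = r $ i" for i
    using fibre_nonempty by metis
  then obtain z w where zw: "\<And>i. z i * w i = theta \<tau> (x $ i)" "\<And>i. moment \<tau> (z i) (w i) (x $ i) = r $ i"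
    by metis
  define p where "p = ((\<chi> i. z i), (\<chi> i. w i), x)"
  have mu: "muR \<tau> p = r" by (simp add: vec_eq_iff p_def muR_nth zw)
  have "p \<in> level \<tau> u a b" using rx zw(1) mu unfolding p_def level_iff base_def by simp
  then obtain DM where DM: "((\<lambda>q. (muR \<tau> q, muC q)) has_derivative DM) (at p)"
    "\<And>c e. \<exists>v. iotaR_eq u (fst (DM v)) c"
    using reg unfolding regular_value_def by meson
  have D: "(muR \<tau> has_derivative (\<lambda>v. fst (DM v))) (at p)"
    using has_derivative_fst[OF DM(1)] by simp
  have zero: "z i = 0 \<and> w i = 0" if "r $ i = 0" "theta \<tau> (x $ i) = 0" for i
    using norms_eq_radius_moment[OF zw(1)[of i]] that unfolding zw(2) by (simp add: radius_def)
  show "no_relation_on u {i. r $ i = 0 \<and> theta \<tau> (x $ i) = 0}"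
    unfolding no_relation_on_def
  proof (intro ballI impI)
    fix \<xi> assume \<xi>: "\<xi> \<in> kR u" "\<forall>i. i \<notin> {i. r $ i = 0 \<and> theta \<tau> (x $ i) = 0} \<longrightarrow> \<xi> $ i = 0"
    obtain v where v: "iotaR_eq u (fst (DM v)) \<xi>" using DM(2) by blast
    have "fst (DM v) $ i * \<xi> $ i = 0" for i
      using muR_derivative_zero[OF D[unfolded p_def], of i v] zero \<xi>(2) by (cases "\<xi> $ i = 0") auto
    then have "fst (DM v) \<bullet> \<xi> = 0" unfolding inner_vec_sum by (intro sum.neutral) blast
    then show "\<xi> = 0" using v \<xi>(1) by (simp add: iotaR_eq_inner)
  qed
qed

theorem theorem3p7:
  fixes \<tau> :: complex and u :: "'n::finite \<Rightarrow> int^'d::finite"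
    and a a' :: "real^'n" and b b' :: "complex^'n"
  assumes "Im \<tau> > 0"
    and "\<forall>i. primitive_vec (u i)"
    and "spans_lattice u"
    and "regular_value \<tau> u a b"
    and "regular_value \<tau> u a' b'"
  shows "Mtilde \<tau> u a b homeomorphic_space Mtilde \<tau> u a' b'"
proof -
  \<comment> \<open>Fixing \<open>c\<close> before the real parameters lets both chains end over the
    same complex parameter; their real parameters may still lie in different chambers.\<close>
  obtain c where c: "transversal_C \<tau> u c" using transversal_C_exists[OF assms(1)] .
  have to_c: "\<exists>s. Mtilde \<tau> u r x homeomorphic_space Mtilde \<tau> u s c"
    if reg: "regular_value \<tau> u r x" for r x
  proof -
    obtain d where d: "d > 0" "\<And>s. dist r s < d \<Longrightarrow> Mtilde \<tau> u r x homeomorphic_space Mtilde \<tau> u s x"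
      using small_real_move[OF assms(1) regular_value_imp_generic[OF reg]] by metis
    obtain s where "dist r s < d" "transversal_R u s" using transversal_R_dense[OF d(1)] .
    then show ?thesis
      using d(2) complex_parameter_irrelevant[OF assms(1)] homeomorphic_space_trans by blast
  qed
  obtain s s' where "Mtilde \<tau> u a b homeomorphic_space Mtilde \<tau> u s c"
    "Mtilde \<tau> u a' b' homeomorphic_space Mtilde \<tau> u s' c"
    using to_c assms(4,5) by blast
  moreover have "Mtilde \<tau> u s c homeomorphic_space Mtilde \<tau> u s' c"
    by (rule real_parameter_irrelevant[OF assms(1) c])
  ultimately show ?thesis by (meson homeomorphic_space_sym homeomorphic_space_trans)
qed

end
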